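(* Let $\mathcal{M}$ be any positroid, of rank $r$. Then its $h$-vector $(h_0,\dots,h_r)$ is a pure $O$-sequence.
   Context: **Le-diagrams.** Fix $n\ge k\ge 0$ and a Young diagram $\lambda$ (English notation, rows left-justified and weakly decreasing from top to bottom) contained in a $k\times(n-k)$ rectangle; rows and columns of length $0$ are allowed. The boundary path of $\lambda$ is the lattice path of $n$ unit steps from the northeast corner to the southwest corner of the rectangle following the southeastern boundary of $\lambda$. Label its steps $1,\dots,n$ in this order. Each row is indexed by the label of the vertical step at its right end, and each column by the label of the horizontal step at its bottom end (so row labels increase downward and column labels increase from right to left). The box in row $i$ and column $j$ is denoted $(i,j)$. A Le-diagram $L$ of shape $\lambda$ is a placement of dots in some of the boxes ($L_{i,j}=1$ if box $(i,j)$ has a dot, $L_{i,j}=0$ otherwise) such that for any three boxes $(i,j),(i',j),(i,j')$ of $\lambda$ with $i'<i$ and $j'>j$, if $L_{i',j}=L_{i,j'}=1$ then $L_{i,j}=1$. **Le-graph.** Place a boundary vertex labeled $m$ in the middle of the $m$-th step of the boundary path, $m=1,\dots,n$. The vertices of the Le-graph are the boundary vertices and the dots of $L$. From each dot draw a horizontal edge to its right and a vertical edge downward, each until it reaches the next dot in that row (column) or, if there is none, the boundary vertex of that row (column). Orient horizontal edges to the left and vertical edges downward. The boundary vertices on vertical steps (row labels) are the sources, those on horizontal steps (column labels) are the sinks. Let $B_0\subseteq[n]$ be the set of sources. A path is a directed path with at least one edge starting and ending at boundary vertices (hence from a source to a sink). A family of non-touching paths is a (possibly empty) finite family of pairwise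 vertex-disjoint paths. A family $p_1,\dots,p_m$, with $p_i$ going from source $s_i$ to sink $k_i$, represents the set $(B_0\setminus\{s_1,\dots,s_m\})\cup\{k_1,\dots,k_m\}$. **Positroid.** The positroid $\mathcal{M}_L$ is the matroid on the ground set $[n]=\{1,\dots,n\}$ whose bases are exactly the sets represented by families of non-touching paths in the Le-graph of $L$. A positroid is a matroid of the form $\mathcal{M}_L$ for some Le-diagram $L$. **$h$-vector.** For a matroid of rank $r$ on a totally ordered ground set, an element $i$ of a basis $B$ is passive if $(B\setminus\{i\})\cup\{j\}$ is a basis for some $j<i$. The $h$-vector is $(h_0,\dots,h_r)$ where $h_i$ is the number of bases having exactly $i$ passive elements. (This does not depend on the chosen order.) **Pure $O$-sequences.** An order ideal is a finite nonempty collection $X$ of monomials such that if $M\in X$ and $N$ divides $M$ then $N\in X$. Its $O$-sequence is $(f_0,\dots,f_d)$, where $f_i$ is the number of monomials of degree $i$ in $X$ and $d$ is the maximal degree in $X$. It is pure if all elements of $X$ that are maximal under divisibility have the same degree. A pure $O$-sequence is the $O$-sequence of a pure order ideal. Sequences are considered up to trailing zeros (so that deleting a loop or contracting a coloop does not change the $h$-vector). *)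

theory Defs
  imports
    "HOL-Library.Multiset"
    "HOL-Library.More_List"
    "Graph_Theory.Graph_Theory"
begin

section \<open>Matroids and h-vectors\<close>

definition matroid :: "'a set \<Rightarrow> 'a set set \<Rightarrow> bool" where
  "matroid E \<B> \<longleftrightarrow> finite E \<and> \<B> \<noteq> {} \<and> (\<forall>B\<in>\<B>. B \<subseteq> E) \<and>
     (\<forall>A\<in>\<B>. \<forall>B\<in>\<B>. \<forall>a\<in>A - B. \<exists>b\<in>B - A. insert b (A - {a}) \<in> \<B>)"

text \<open>Well defined for matroids only, where all bases have the same cardinality.\<close>

definition matroid_rank :: "'a set set \<Rightarrow> nat" where
  "matroid_rank \<B> = (THE r. \<forall>B\<in>\<B>. card B = r)"

text \<open>
  The ground set need not be mentioned: \<open>insert j (B - {i}) \<in> \<B>\<close> forces \<open>j\<close> into it.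
\<close>

definition passive_element :: "'a::linorder set set \<Rightarrow> 'a set \<Rightarrow> 'a \<Rightarrow> bool" where
  "passive_element \<B> B i \<longleftrightarrow> i \<in> B \<and> (\<exists>j<i. insert j (B - {i}) \<in> \<B>)"

definition h_number :: "'a::linorder set set \<Rightarrow> nat \<Rightarrow> nat" where
  "h_number \<B> i = card {B \<in> \<B>. card {e. passive_element \<B> B e} = i}"

definition h_vector :: "'a::linorder set set \<Rightarrow> nat list" where
  "h_vector \<B> = map (h_number \<B>) [0..<Suc (matroid_rank \<B>)]"


section \<open>Pure O-sequences\<close>

text \<open>
  A monomial is identified with the multiset of its variables, which are indexed by natural
  numbers (a finite collection of monomials involves finitely many of them).  Thus divisibility
  is \<open>\<subseteq>#\<close> and the degree is \<open>size\<close>.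
\<close>

type_synonym monomial = "nat multiset"

definition order_ideal :: "monomial set \<Rightarrow> bool" where
  "order_ideal X \<longleftrightarrow> finite X \<and> X \<noteq> {} \<and> (\<forall>M\<in>X. \<forall>N. N \<subseteq># M \<longrightarrow> N \<in> X)"

definition maximal_monomial :: "monomial set \<Rightarrow> monomial \<Rightarrow> bool" where
  "maximal_monomial X M \<longleftrightarrow> M \<in> X \<and> (\<forall>N\<in>X. M \<subseteq># N \<longrightarrow> N = M)"

definition pure_ideal :: "monomial set \<Rightarrow> bool" where
  "pure_ideal X \<longleftrightarrow> (\<forall>M N. maximal_monomial X M \<and> maximal_monomial X N \<longrightarrow> size M = size N)"

definition O_sequence :: "monomial set \<Rightarrow> nat list" where
  "O_sequence X = map (\<lambda>i. card {M \<in> X. size M = i}) [0..<Suc (Max (size ` X))]"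

definition eq_up_to_trailing_zeros :: "nat list \<Rightarrow> nat list \<Rightarrow> bool" where
  "eq_up_to_trailing_zeros xs ys \<longleftrightarrow> strip_while (\<lambda>x. x = 0) xs = strip_while (\<lambda>x. x = 0) ys"

definition pure_O_sequence :: "nat list \<Rightarrow> bool" where
  "pure_O_sequence xs \<longleftrightarrow>
     (\<exists>X. order_ideal X \<and> pure_ideal X \<and> eq_up_to_trailing_zeros xs (O_sequence X))"


section \<open>Young diagrams and Le-diagrams\<close>

text \<open>
  A Young diagram in a \<open>k \<times> (n - k)\<close> rectangle is the list of its \<open>k\<close> row lengths, from top to
  bottom.  Rows \<open>a < k\<close> are counted from the top and columns \<open>c < n - k\<close> from the left, starting
  with 0.
\<close>

definition young_diagram :: "nat \<Rightarrow> nat \<Rightarrow> nat list \<Rightarrow> bool" where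
  "young_diagram n k \<mu> \<longleftrightarrow>
     k \<le> n \<and> length \<mu> = k \<and> sorted_wrt (\<ge>) \<mu> \<and> (\<forall>x\<in>set \<mu>. x \<le> n - k)"

definition column_length :: "nat list \<Rightarrow> nat \<Rightarrow> nat" where
  "column_length \<mu> c = card {a. a < length \<mu> \<and> c < \<mu> ! a}"

text \<open>
  Give lattice points coordinates \<open>(x, y)\<close>, with \<open>x\<close> the distance from the left side of the
  rectangle and \<open>y\<close> the distance from its top side.  The boundary path starts at \<open>(n - k, 0)\<close> and
  its unit steps decrease \<open>x\<close> or increase \<open>y\<close>, so the step ending at \<open>(x, y)\<close> has the label
  \<open>((n - k) - x) + y\<close>.  The vertical step of row \<open>a\<close> ends at \<open>(\<mu> ! a, a + 1)\<close>; the horizontal step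
  of column \<open>c\<close> ends at \<open>(c, column_length \<mu> c)\<close>.
\<close>

definition row_label :: "nat \<Rightarrow> nat list \<Rightarrow> nat \<Rightarrow> nat" where
  "row_label n \<mu> a = ((n - length \<mu>) - \<mu> ! a) + (a + 1)"

definition column_label :: "nat \<Rightarrow> nat list \<Rightarrow> nat \<Rightarrow> nat" where
  "column_label n \<mu> c = ((n - length \<mu>) - c) + column_length \<mu> c"

definition row_labels :: "nat \<Rightarrow> nat list \<Rightarrow> nat set" where
  "row_labels n \<mu> = row_label n \<mu> ` {..<length \<mu>}"

definition boxes :: "nat \<Rightarrow> nat list \<Rightarrow> (nat \<times> nat) set" where
  "boxes n \<mu> = {(row_label n \<mu> a, column_label n \<mu> c) | a c. a < length \<mu> \<and> c < \<mu> ! a}"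

text \<open>A Le-diagram of shape \<open>\<mu>\<close> is represented by the set \<open>D\<close> of its boxes with a dot.\<close>

definition le_diagram :: "nat \<Rightarrow> nat \<Rightarrow> nat list \<Rightarrow> (nat \<times> nat) set \<Rightarrow> bool" where
  "le_diagram n k \<mu> D \<longleftrightarrow> young_diagram n k \<mu> \<and> D \<subseteq> boxes n \<mu> \<and>
     (\<forall>i i' j j'. (i, j) \<in> boxes n \<mu> \<and> (i', j) \<in> boxes n \<mu> \<and> (i, j') \<in> boxes n \<mu> \<and>
        i' < i \<and> j < j' \<and> (i', j) \<in> D \<and> (i, j') \<in> D \<longrightarrow> (i, j) \<in> D)"


section \<open>Le-graphs and positroids\<close>

datatype le_vertex = Boundary nat | Dot nat nat

text \<open>
  Column labels increase from right to left, so in a row \<open>i\<close> the dots to the right of \<open>(i, j)\<close> are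
  those with smaller column label.
\<close>

inductive_set le_arcs :: "(nat \<times> nat) set \<Rightarrow> (le_vertex \<times> le_vertex) set"
  for D :: "(nat \<times> nat) set" where
  left_dot:
    "\<lbrakk>(i, j) \<in> D; (i, j') \<in> D; j' < j; \<And>l. j' < l \<Longrightarrow> l < j \<Longrightarrow> (i, l) \<notin> D\<rbrakk>
      \<Longrightarrow> (Dot i j', Dot i j) \<in> le_arcs D"
| left_boundary:
    "\<lbrakk>(i, j) \<in> D; \<And>l. l < j \<Longrightarrow> (i, l) \<notin> D\<rbrakk> \<Longrightarrow> (Boundary i, Dot i j) \<in> le_arcs D"
| down_dot:
    "\<lbrakk>(i, j) \<in> D; (i', j) \<in> D; i < i'; \<And>l. i < l \<Longrightarrow> l < i' \<Longrightarrow> (l, j) \<notin> D\<rbrakk>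
      \<Longrightarrow> (Dot i j, Dot i' j) \<in> le_arcs D"
| down_boundary:
    "\<lbrakk>(i, j) \<in> D; \<And>l. i < l \<Longrightarrow> (l, j) \<notin> D\<rbrakk> \<Longrightarrow> (Dot i j, Boundary j) \<in> le_arcs D"

definition le_graph :: "nat \<Rightarrow> (nat \<times> nat) set \<Rightarrow> le_vertex pair_pre_digraph" where
  "le_graph n D =
     \<lparr>pverts = Boundary ` {1..n} \<union> {Dot i j | i j. (i, j) \<in> D}, parcs = le_arcs D\<rparr>"

definition le_path :: "nat \<Rightarrow> (nat \<times> nat) set \<Rightarrow> le_vertex list \<Rightarrow> bool" where
  "le_path n D p \<longleftrightarrow> vpath p (with_proj (le_graph n D)) \<and> vwalk_length p \<ge> 1 \<and>
     hd p \<in> range Boundary \<and> last p \<in> range Boundary"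

definition non_touching :: "nat \<Rightarrow> (nat \<times> nat) set \<Rightarrow> le_vertex list set \<Rightarrow> bool" where
  "non_touching n D P \<longleftrightarrow> finite P \<and> (\<forall>p\<in>P. le_path n D p) \<and>
     pairwise (\<lambda>p q. disjnt (set p) (set q)) P"

definition represented_set :: "nat \<Rightarrow> nat list \<Rightarrow> le_vertex list set \<Rightarrow> nat set" where
  "represented_set n \<mu> P =
     (row_labels n \<mu> - {s. \<exists>p\<in>P. hd p = Boundary s}) \<union> {t. \<exists>p\<in>P. last p = Boundary t}"

definition le_bases :: "nat \<Rightarrow> nat list \<Rightarrow> (nat \<times> nat) set \<Rightarrow> nat set set" where
  "le_bases n \<mu> D = {represented_set n \<mu> P | P. non_touching n D P}"

definition positroid :: "nat set \<Rightarrow> nat set set \<Rightarrow> bool" where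
  "positroid E \<B> \<longleftrightarrow> matroid E \<B> \<and>
     (\<exists>n k \<mu> D. le_diagram n k \<mu> D \<and> E = {1..n} \<and> \<B> = le_bases n \<mu> D)"

end

theory Submission
  imports Defs
begin

text \<open>
  Let \<open>R\<close> be the set of sources.  A path forest consists of one path for each row \<open>i\<close> in a set
  \<open>A \<subseteq> R\<close>, such that paths with different sinks are disjoint.  The multisets of sinks of path forests
  form an order ideal, since paths can be dropped.  It is pure: a row \<open>e\<close> with a dot and without a path
  can always be given one, by going from \<open>e\<close> to some dot and then straight down, and following the first
  tree that is met.  So the maximal multisets have as many elements as there are rows with a dot.

  Keeping only the topmost path to each sink of a path forest gives a family of non-touching paths,
  hence a basis \<open>B\<close>.  The sinks in \<open>B\<close> and the other rows in \<open>A\<close> are passive in \<open>B\<close>, and these are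
  \<open>|A|\<close> elements.  Call the forest saturated if \<open>B\<close> has no further passive elements.  Every basis
  comes from a saturated forest and every multiset of sinks is that of a saturated forest, because a
  passive row outside \<open>A\<close> can be attached to a tree that contains a higher row.  Finally, for saturated
  forests the basis and the multiset of sinks determine each other, so bases with \<open>i\<close> passive elements
  correspond to monomials of degree \<open>i\<close>.
\<close>

section \<open>Lattice paths\<close>

text \<open>
  The dot in row \<open>i\<close> and column \<open>j\<close> is the lattice point \<open>(i, j)\<close>, where \<open>i < j\<close>, and the boundary
  vertex \<open>m\<close> is \<open>(m, m)\<close>.  A path from \<open>b\<close> to \<open>c\<close> runs through one lattice point \<open>(s - J s, J s)\<close> at
  each time \<open>s\<close> from \<open>2 * b\<close> to \<open>2 * c\<close> and turns only at dots; the values of \<open>J\<close> at other times are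
  irrelevant.
\<close>

definition lpath :: "(nat \<times> nat) set \<Rightarrow> nat \<Rightarrow> nat \<Rightarrow> (nat \<Rightarrow> nat) \<Rightarrow> bool" where
  "lpath D b c J \<longleftrightarrow> b < c \<and> J (2 * b) = b \<and> J (2 * c) = c \<and>
     (\<forall>s. 2 * b \<le> s \<and> s < 2 * c \<longrightarrow> J (Suc s) = J s \<or> J (Suc s) = Suc (J s)) \<and>
     (\<forall>s. 2 * b < s \<and> s < 2 * c \<longrightarrow> s < 2 * J s) \<and>
     (\<forall>s. 2 * b \<le> s \<and> Suc (Suc s) \<le> 2 * c \<and> (Suc s - J (Suc s), J (Suc s)) \<notin> D \<longrightarrow>
        J (Suc (Suc s)) + J s = 2 * J (Suc s))"

text \<open>A lattice point determines the time at which a path visits it, so common points are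
  equal values at equal times. End points are left out: paths to the same sink do not meet just
  because of it.\<close>

definition meet :: "nat \<Rightarrow> nat \<Rightarrow> (nat \<Rightarrow> nat) \<Rightarrow> nat \<Rightarrow> nat \<Rightarrow> (nat \<Rightarrow> nat) \<Rightarrow> nat \<Rightarrow> bool" where
  "meet b c J b' c' J' s \<longleftrightarrow>
     2 * b < s \<and> s < 2 * c \<and> 2 * b' < s \<and> s < 2 * c' \<and> J s = J' s"

text \<open>A class of paths with a common sink is called a tree, although its paths may meet and
  part again.\<close>

definition path_forest ::
  "(nat \<times> nat) set \<Rightarrow> nat set \<Rightarrow> (nat \<Rightarrow> nat) \<Rightarrow> (nat \<Rightarrow> nat \<Rightarrow> nat) \<Rightarrow> bool" where
  "path_forest D A f \<Gamma> \<longleftrightarrow> (\<forall>i\<in>A. lpath D i (f i) (\<Gamma> i)) \<and>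
     (\<forall>i\<in>A. \<forall>l\<in>A. f i \<noteq> f l \<longrightarrow> (\<nexists>s. meet i (f i) (\<Gamma> i) l (f l) (\<Gamma> l) s))"

section \<open>Geometry of a single path\<close>

lemma lpathD:
  assumes "lpath D b c J"
  shows "b < c" "J (2 * b) = b" "J (2 * c) = c"
    "2 * b \<le> s \<Longrightarrow> s < 2 * c \<Longrightarrow> J (Suc s) = J s \<or> J (Suc s) = Suc (J s)"
    "2 * b < s \<Longrightarrow> s < 2 * c \<Longrightarrow> s < 2 * J s"
    "2 * b \<le> s \<Longrightarrow> Suc (Suc s) \<le> 2 * c \<Longrightarrow> (Suc s - J (Suc s), J (Suc s)) \<notin> D \<Longrightarrow>
      J (Suc (Suc s)) + J s = 2 * J (Suc s)"
  using assms unfolding lpath_def by blast+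

lemma lpath_mono:
  assumes "lpath D b c J" "2 * b \<le> s" "s \<le> t" "t \<le> 2 * c"
  shows "J s \<le> J t" "J t \<le> J s + (t - s)"
proof -
  have "J s \<le> J t \<and> J t \<le> J s + (t - s)"
    using assms(3,4)
  proof (induction t rule: dec_induct)
    case (step t)
    then show ?case using lpathD(4)[OF assms(1), of t] assms(2) by force
  qed auto
  then show "J s \<le> J t" "J t \<le> J s + (t - s)" by auto
qed

lemma lpath_bounds:
  assumes "lpath D b c J" "2 * b \<le> s" "s \<le> 2 * c"
  shows "b \<le> J s" "J s + b \<le> s" "J s \<le> c" "s \<le> J s + c"
proof -
  note lp = lpath_mono[OF assms(1)] lpathD(2,3)[OF assms(1)]
  show "b \<le> J s" "J s + b \<le> s" using lp(1,2)[of "2 * b" s] lp(3) assms by auto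
  show "J s \<le> c" "s \<le> J s + c" using lp(1,2)[of s "2 * c"] lp(4) assms by auto
qed

text \<open>Between its end points a path stays strictly inside the diagram, so it leaves its source
  horizontally and enters its sink vertically.\<close>

lemma lpath_last:
  assumes "lpath D b c J"
  shows "J (2 * c - 1) = c" "2 * b < 2 * c - 1" "J (Suc (2 * b)) = Suc b"
proof -
  have bc: "b < c" using lpathD(1)[OF assms] .
  then show *: "2 * b < 2 * c - 1" by linarith
  have "2 * c - 1 < 2 * J (2 * c - 1)" using lpathD(5)[OF assms *] bc by linarith
  moreover have "J (2 * c - 1) \<le> c" using lpath_bounds(3)[OF assms, of "2 * c - 1"] bc by linarith
  ultimately show "J (2 * c - 1) = c" by linarith
  have "Suc (2 * b) < 2 * J (Suc (2 * b))" using lpathD(5)[OF assms, of "Suc (2 * b)"] bc by linarith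
  moreover have "J (Suc (2 * b)) \<le> Suc b"
    using lpathD(4)[OF assms, of "2 * b"] lpathD(2)[OF assms] bc by auto
  ultimately show "J (Suc (2 * b)) = Suc b" by linarith
qed

text \<open>A path goes straight on until a dot and does not enter its sink horizontally, so a
  horizontal step is followed by a dot further left in its row.\<close>

lemma lpath_horizontal:
  assumes "lpath D b c J"
  shows "2 * b \<le> s \<Longrightarrow> s < 2 * c \<Longrightarrow> J (Suc s) = Suc (J s) \<Longrightarrow> \<exists>j > J s. (s - J s, j) \<in> D"
proof (induction "2 * c - s" arbitrary: s)
  case 0
  then show ?case by simp
next
  case (Suc x)
  note lp = lpathD[OF assms]
  have ne: "Suc s < 2 * c"
  proof (rule ccontr)
    assume "\<not> Suc s < 2 * c"
    then have "s = 2 * c - 1" "Suc s = 2 * c" using Suc.prems by auto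
    then show False using lpath_last(1)[OF assms] lp(3) Suc.prems(3) by auto
  qed
  show ?case
  proof (cases "(Suc s - J (Suc s), J (Suc s)) \<in> D")
    case True
    then show ?thesis using Suc.prems(3) by auto
  next
    case False
    then have "J (Suc (Suc s)) + J s = 2 * J (Suc s)" using lp(6)[of s] ne Suc.prems by auto
    then have "J (Suc (Suc s)) = Suc (J (Suc s))" using Suc.prems(3) by linarith
    moreover have "x = 2 * c - Suc s" using Suc.hyps(2) by linarith
    ultimately have "\<exists>j>J (Suc s). (Suc s - J (Suc s), j) \<in> D"
      using Suc.hyps(1)[of "Suc s"] Suc.prems ne by auto
    then show ?thesis unfolding Suc.prems(3) diff_Suc_Suc using Suc_lessD by blast
  qed
qed

text \<open>Mirror image: as the first step is horizontal, the path has turned down at a dot of this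
  column, at the latest where the step begins.\<close>

lemma lpath_vertical:
  assumes "lpath D b c J"
  shows "2 * b \<le> s \<Longrightarrow> s < 2 * c \<Longrightarrow> J (Suc s) = J s \<Longrightarrow> \<exists>i < Suc s - J s. (i, J s) \<in> D"
proof (induction s)
  case 0
  then have "b = 0" by simp
  then show ?case using lpath_last(3)[OF assms] lpathD(2)[OF assms] 0 by auto
next
  case (Suc s)
  note lp = lpathD[OF assms]
  have ne: "2 * b \<le> s"
  proof (rule ccontr)
    assume "\<not> 2 * b \<le> s"
    then have "Suc s = 2 * b" using Suc.prems by auto
    then show False using lpath_last(3)[OF assms] lp(2) Suc.prems(3) by auto
  qed
  have JS: "J (Suc s) \<le> Suc s" using lpath_bounds(2)[OF assms, of "Suc s"] Suc.prems by simp
  have Js: "J s \<le> s" using lpath_bounds(2)[OF assms, of "s"] Suc.prems ne by simp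
  show ?case
  proof (cases "(Suc s - J (Suc s), J (Suc s)) \<in> D")
    case True
    then show ?thesis using JS by (intro exI[of _ "Suc s - J (Suc s)"]) auto
  next
    case False
    then have "J (Suc (Suc s)) + J s = 2 * J (Suc s)" using lp(6)[of s] ne Suc.prems by auto
    then have e: "J (Suc s) = J s" using Suc.prems(3) by linarith
    then obtain i where "i < Suc s - J s" "(i, J s) \<in> D" using Suc.IH Suc.prems ne by auto
    then show ?thesis using e by (intro exI[of _ i]) auto
  qed
qed

lemma lpath_row:
  assumes "lpath D b c J"
  shows "b \<in> fst ` D"
  using lpath_horizontal[OF assms, of "2 * b"] lpathD(1,2)[OF assms] lpath_last(3)[OF assms]
  by force

lemma lpath_col:
  assumes "lpath D b c J"
  shows "c \<in> snd ` D"
  using lpath_vertical[OF assms, of "2 * c - 1"] lpathD(1,3)[OF assms] lpath_last(1,2)[OF assms]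
  by force

text \<open>The shape of the diagram is encoded by the order of the labels: a row \<open>i\<close>
  and a column \<open>j\<close> have a common box iff \<open>i < j\<close>. So \<open>i < j\<close>
  in \<open>le_closed\<close> says that \<open>(i, j)\<close> is a box.\<close>

locale le_dots =
  fixes D :: "(nat \<times> nat) set" and R :: "nat set"
  assumes finite_rows: "finite R"
    and finite_dots: "finite D"
    and dot_row: "(i, j) \<in> D \<Longrightarrow> i \<in> R"
    and dot_col: "(i, j) \<in> D \<Longrightarrow> j \<notin> R"
    and dot_less: "(i, j) \<in> D \<Longrightarrow> i < j"
    and le_closed: "(i', j) \<in> D \<Longrightarrow> (i, j') \<in> D \<Longrightarrow> i' < i \<Longrightarrow> i < j \<Longrightarrow> j < j' \<Longrightarrow> (i, j) \<in> D"
begin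

text \<open>This is the only use of the Le-property.\<close>

lemma no_crossing:
  assumes "lpath D b c J" "lpath D b' c' J'" "meet b c J b' c' J' s" "(s - J s, J s) \<notin> D"
  shows "J (Suc s) = J' (Suc s)" "J (s - 1) = J' (s - 1)"
proof -
  have *: "J (Suc s) = J' (Suc s) \<and> J (s - 1) = J' (s - 1)"
    if lp: "lpath D b c J" "lpath D b' c' J'" and m: "meet b c J b' c' J' s"
      and nd: "(s - J s, J s) \<notin> D" and le: "J (Suc s) \<le> J' (Suc s)" for b c J b' c' J'
  proof -
    note m = m[unfolded meet_def]
    obtain t where t: "s = Suc t" using m by (cases s) auto
    have st: "J (Suc (Suc t)) + J t = 2 * J (Suc t)" "J' (Suc (Suc t)) + J' t = 2 * J' (Suc t)"
      using lpathD(6)[OF lp(1), of t] lpathD(6)[OF lp(2), of t] m nd t by auto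
    show ?thesis
    proof (cases "J (Suc s) = J' (Suc s)")
      case True
      then show ?thesis using st m t by auto
    next
      case False
      \<comment> \<open>\<open>J\<close> passes the point downward, so there is a dot above it;
        \<open>J'\<close> passes it to the left, so there is a dot to its left. The Le-property then
        puts a dot on the point itself.\<close>
      then have "J (Suc s) = J s" "J' (Suc s) = Suc (J' s)"
        using le lpathD(4)[OF lp(1), of s] lpathD(4)[OF lp(2), of s] m by auto
      moreover from this have "J (Suc t) = J t" using st t by auto
      ultimately obtain i j where ij: "i < Suc t - J t" "(i, J t) \<in> D" "j > J' s" "(s - J' s, j) \<in> D"
        using lpath_vertical[OF lp(1), of t] lpath_horizontal[OF lp(2), of s] m t by auto
      have "s < 2 * J s" using lpathD(5)[OF lp(1), of s] m by auto
      then have "(s - J s, J s) \<in> D"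
        using le_closed[OF ij(2,4)] ij m t \<open>J (Suc t) = J t\<close> by auto
      then show ?thesis using nd by simp
    qed
  qed
  have m': "meet b' c' J' b c J s" "(s - J' s, J' s) \<notin> D"
    using assms(3,4) by (auto simp: meet_def)
  show "J (Suc s) = J' (Suc s)" "J (s - 1) = J' (s - 1)"
    using *[OF assms] *[OF assms(2,1) m'] by (metis linear)+
qed

text \<open>Changing paths at time \<open>s\<close> creates a turn only if the common point is a
  dot: elsewhere, by \<open>no_crossing\<close>, the two paths also agree one step before and one
  step after.\<close>

lemma lpath_splice:
  assumes lp: "lpath D b c J" "lpath D b' c' J'" and m: "meet b c J b' c' J' s"
  shows "lpath D b c' (\<lambda>t. if t \<le> s then J t else J' t)" (is "lpath D b c' ?K")
proof -
  note m' = m[unfolded meet_def] and l1 = lpathD[OF lp(1)] and l2 = lpathD[OF lp(2)]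
  have "?K (Suc (Suc t)) + ?K t = 2 * ?K (Suc t)"
    if t: "2 * b \<le> t" "Suc (Suc t) \<le> 2 * c'" "(Suc t - ?K (Suc t), ?K (Suc t)) \<notin> D" for t
  proof -
    consider "Suc t < s" | "Suc t = s" | "t = s" | "s < t" by linarith
    then show ?thesis
    proof cases
      case 1
      then show ?thesis using l1(6)[of t] t m' by auto
    next
      case 2
      then show ?thesis using l1(6)[of t] t m' no_crossing[OF lp m] by auto
    next
      case 3
      then show ?thesis using l2(6)[of t] t m' by auto
    next
      case 4
      then show ?thesis using l2(6)[of t] t m' by auto
    qed
  qed
  moreover have "?K (Suc t) = ?K t \<or> ?K (Suc t) = Suc (?K t)" if "2 * b \<le> t" "t < 2 * c'" for t
    using l1(4)[of t] l2(4)[of t] that m' by (cases "t = s") auto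
  moreover have "t < 2 * ?K t" if "2 * b < t" "t < 2 * c'" for t
    using l1(5)[of t] l2(5)[of t] that m' by auto
  ultimately show ?thesis
    using l1(2) l2(3) m' unfolding lpath_def by auto
qed

text \<open>A smaller column at the same time means a lower point, so this is the lower envelope. It
  changes between the paths only at common points, where \<open>no_crossing\<close> applies again.
  It starts at \<open>b\<close>, because at time \<open>2 * b\<close> the other path starts there
  too or is strictly inside the diagram.\<close>

lemma lpath_min:
  assumes lp: "lpath D b c J" "lpath D b' c J'" and le: "b' \<le> b"
  shows "lpath D b c (\<lambda>t. min (J t) (J' t))" (is "lpath D b c ?K")
proof -
  note l1 = lpathD[OF lp(1)] and l2 = lpathD[OF lp(2)]
  have "?K (Suc (Suc t)) + ?K t = 2 * ?K (Suc t)"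
    if t: "2 * b \<le> t" "Suc (Suc t) \<le> 2 * c" "(Suc t - ?K (Suc t), ?K (Suc t)) \<notin> D" for t
  proof -
    have s1: "J (Suc t) = J t \<or> J (Suc t) = Suc (J t)" "J' (Suc t) = J' t \<or> J' (Suc t) = Suc (J' t)"
      "J (Suc (Suc t)) = J (Suc t) \<or> J (Suc (Suc t)) = Suc (J (Suc t))"
      "J' (Suc (Suc t)) = J' (Suc t) \<or> J' (Suc (Suc t)) = Suc (J' (Suc t))"
      using l1(4)[of t] l2(4)[of t] l1(4)[of "Suc t"] l2(4)[of "Suc t"] t le by auto
    consider "J (Suc t) < J' (Suc t)" | "J' (Suc t) < J (Suc t)" | "J (Suc t) = J' (Suc t)"
      by linarith
    then show ?thesis
    proof cases
      case 1
      then show ?thesis using l1(6)[of t] t s1 by auto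
    next
      case 2
      then show ?thesis using l2(6)[of t] t s1 le by auto
    next
      case 3
      then have "meet b c J b' c J' (Suc t)" using t le by (auto simp: meet_def)
      then show ?thesis using no_crossing[OF lp, of "Suc t"] t 3 l1(6)[of t] by auto
    qed
  qed
  moreover have "?K (Suc t) = ?K t \<or> ?K (Suc t) = Suc (?K t)" if "2 * b \<le> t" "t < 2 * c" for t
    using l1(4)[of t] l2(4)[of t] that le by auto
  moreover have "t < 2 * ?K t" if "2 * b < t" "t < 2 * c" for t
    using l1(5)[of t] l2(5)[of t] that le by auto
  moreover have "b \<le> J' (2 * b)"
  proof (cases "b' = b")
    case False
    then show ?thesis using l2(5)[of "2 * b"] le l1(1) by auto
  qed (use l2 in auto)
  ultimately show ?thesis
    using l1(1-3) l2(3) unfolding lpath_def by auto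
qed

end

text \<open>When the lower path starts, the other one is strictly inside the diagram, hence above
  it. A step changes the difference of the columns by at most one, so the order could only be
  reversed after a meeting.\<close>

lemma lpath_above:
  assumes lp: "lpath D b c J" "lpath D b' c' J'" and nm: "\<nexists>s. meet b c J b' c' J' s"
    and less: "b < b'" "b' < c"
  shows "2 * b' \<le> s \<Longrightarrow> s < 2 * c \<Longrightarrow> s < 2 * c' \<Longrightarrow> J' s < J s"
proof (induction s rule: dec_induct)
  case base
  then show ?case using lpathD(5)[OF lp(1), of "2 * b'"] lpathD(2)[OF lp(2)] less by auto
next
  case (step s)
  have "J' (Suc s) \<le> J (Suc s)"
    using step lpathD(4)[OF lp(1), of s] lpathD(4)[OF lp(2), of s] less by fastforce
  moreover have "J (Suc s) \<noteq> J' (Suc s)"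
    using nm step.hyps step.prems less unfolding meet_def by (auto dest: spec[of _ "Suc s"])
  ultimately show ?case by linarith
qed

text \<open>If \<open>c < c'\<close>, then at time \<open>2 * c - 1\<close> the upper path is in
  column \<open>c\<close>, and there is no point strictly below it that is still strictly inside the
  diagram.\<close>

lemma lpath_nested:
  assumes lp: "lpath D b c J" "lpath D b' c' J'" and nm: "\<nexists>s. meet b c J b' c' J' s"
    and less: "b < b'" "b' < c" and ne: "c \<noteq> c'"
  shows "c' < c" "2 * b' \<le> s \<Longrightarrow> s < 2 * c' \<Longrightarrow> J' s < J s"
proof -
  show *: "c' < c"
  proof (rule ccontr)
    assume "\<not> c' < c"
    then have cc: "c < c'" using ne by simp
    have "J' (2 * c - 1) < J (2 * c - 1)"
      using lpath_above[OF lp nm less, of "2 * c - 1"] less cc by auto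
    moreover have "2 * c - 1 < 2 * J' (2 * c - 1)"
      using lpathD(5)[OF lp(2), of "2 * c - 1"] less cc by auto
    ultimately show False using lpath_last(1)[OF lp(1)] by linarith
  qed
  show "2 * b' \<le> s \<Longrightarrow> s < 2 * c' \<Longrightarrow> J' s < J s"
    using lpath_above[OF lp nm less, of s] * by simp
qed

section \<open>Path forests\<close>

text \<open>The set represented by a non-touching family with sources \<open>A\<close>, where
  \<open>f\<close> maps each source to its sink.\<close>

definition base :: "nat set \<Rightarrow> nat set \<Rightarrow> (nat \<Rightarrow> nat) \<Rightarrow> nat set" where
  "base R A f = (R - A) \<union> f ` A"

text \<open>Row labels increase downward, so these are the topmost rows of the trees.\<close>

definition leads :: "nat set \<Rightarrow> (nat \<Rightarrow> nat) \<Rightarrow> nat set" where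
  "leads A f = {i \<in> A. \<forall>l\<in>A. f l = f i \<longrightarrow> i \<le> l}"

text \<open>Injectivity of \<open>f\<close> makes all paths of the forest pairwise disjoint; these
  are the bases of the positroid in terms of lattice paths.\<close>

definition forest_bases :: "(nat \<times> nat) set \<Rightarrow> nat set \<Rightarrow> nat set set" where
  "forest_bases D R = {base R A f | A f. inj_on f A \<and> (\<exists>\<Gamma>. path_forest D A f \<Gamma>)}"

definition saturated :: "(nat \<times> nat) set \<Rightarrow> nat set \<Rightarrow> nat set \<Rightarrow> (nat \<Rightarrow> nat) \<Rightarrow> bool" where
  "saturated D R A f \<longleftrightarrow>
     (\<forall>e\<in>R - A. \<not> passive_element (forest_bases D R) (base R (leads A f) f) e)"

lemma meet_commute: "meet b c J b' c' J' s \<longleftrightarrow> meet b' c' J' b c J s"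
  by (auto simp: meet_def)

lemma forest_subset: "path_forest D A f \<Gamma> \<Longrightarrow> A' \<subseteq> A \<Longrightarrow> path_forest D A' f \<Gamma>"
  unfolding path_forest_def by blast

lemma forest_less: "path_forest D A f \<Gamma> \<Longrightarrow> i \<in> A \<Longrightarrow> i < f i"
  unfolding path_forest_def using lpathD(1) by blast

lemma forest_nested:
  assumes "path_forest D A f \<Gamma>" "i \<in> A" "l \<in> A" "i < l" "l < f i" "f i \<noteq> f l"
  shows "f l < f i" "2 * l \<le> s \<Longrightarrow> s < 2 * f l \<Longrightarrow> \<Gamma> l s < \<Gamma> i s"
proof -
  have "lpath D i (f i) (\<Gamma> i)" "lpath D l (f l) (\<Gamma> l)"
    "\<nexists>s. meet i (f i) (\<Gamma> i) l (f l) (\<Gamma> l) s"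
    using assms unfolding path_forest_def by auto
  note nested = lpath_nested[OF this assms(4-6)]
  show "f l < f i" "2 * l \<le> s \<Longrightarrow> s < 2 * f l \<Longrightarrow> \<Gamma> l s < \<Gamma> i s"
    using nested by simp_all
qed

lemma leads_subset: "leads A f \<subseteq> A"
  by (auto simp: leads_def)

lemma inj_on_leads: "inj_on f (leads A f)"
  by (auto simp: leads_def inj_on_def intro: antisym)

lemma ex_lead:
  fixes f :: "nat \<Rightarrow> nat"
  assumes "i \<in> A"
  obtains m where "m \<in> leads A f" "f m = f i" "m \<le> i"
proof -
  define m where "m = (LEAST m. m \<in> A \<and> f m = f i)"
  have "m \<in> A \<and> f m = f i" unfolding m_def by (rule LeastI[of _ i]) (use assms in simp)
  moreover have "m \<le> l" if "l \<in> A" "f l = f i" for l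
    unfolding m_def using that by (intro Least_le) simp
  ultimately show ?thesis using that assms by (auto simp: leads_def)
qed

lemma image_leads: "f ` leads A f = f ` A"
  using leads_subset[of A f] by (auto elim!: ex_lead[of _ A f] intro: rev_image_eqI)

lemma forest_leads: "path_forest D A f \<Gamma> \<Longrightarrow> path_forest D (leads A f) f \<Gamma>"
  by (rule forest_subset[OF _ leads_subset])

lemma forest_basesI: "path_forest D A f \<Gamma> \<Longrightarrow> inj_on f A \<Longrightarrow> base R A f \<in> forest_bases D R"
  unfolding forest_bases_def by blast

lemma base_leads_in: "path_forest D A f \<Gamma> \<Longrightarrow> base R (leads A f) f \<in> forest_bases D R"
  by (intro forest_basesI forest_leads inj_on_leads)

lemma base_leads: "base R (leads A f) f = (R - leads A f) \<union> f ` A"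
  by (simp add: base_def image_leads)

text \<open>This keeps the basis fixed while rows are attached to trees.\<close>

lemma leads_insert:
  assumes "m \<in> A" "f m = u" "m < e" "e \<notin> A"
  shows "leads (insert e A) (f(e := u)) = leads A f"
proof (intro equalityI subsetI)
  fix i assume "i \<in> leads (insert e A) (f(e := u))"
  then have i: "i \<in> insert e A"
    "\<And>l. l \<in> insert e A \<Longrightarrow> (f(e := u)) l = (f(e := u)) i \<Longrightarrow> i \<le> l"
    unfolding leads_def by auto
  then have "i \<noteq> e" using i(2)[of m] assms by force
  moreover have "i \<le> l" if "l \<in> A" "f l = f i" for l
    using i(2)[of l] that \<open>i \<noteq> e\<close> assms(4) by (cases "l = e") auto
  ultimately show "i \<in> leads A f" using i(1) unfolding leads_def by auto
next
  fix i assume i: "i \<in> leads A f"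
  then have "f m = f i \<Longrightarrow> i \<le> m" using assms(1) unfolding leads_def by auto
  then show "i \<in> leads (insert e A) (f(e := u))"
    using i assms unfolding leads_def by (auto simp: fun_upd_def)
qed

section \<open>Attaching rows to forests; uniqueness of noncrossing matchings\<close>

context le_dots
begin

lemma forest_rows:
  assumes "path_forest D A f \<Gamma>"
  shows "A \<subseteq> R" "finite A"
proof -
  show "A \<subseteq> R" using assms unfolding path_forest_def using lpath_row dot_row by fastforce
  then show "finite A" using finite_rows finite_subset by blast
qed

lemma forest_cols: "path_forest D A f \<Gamma> \<Longrightarrow> f ` A \<inter> R = {}"
  unfolding path_forest_def using lpath_col dot_col by fastforce

lemma forest_insert:
  assumes F: "path_forest D A f \<Gamma>" and e: "e \<notin> A" and q: "lpath D e u q"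
    and nm: "\<And>l s. l \<in> A \<Longrightarrow> f l \<noteq> u \<Longrightarrow> \<not> meet e u q l (f l) (\<Gamma> l) s"
  shows "path_forest D (insert e A) (f(e := u)) (\<Gamma>(e := q))"
  unfolding path_forest_def
proof (intro conjI ballI impI notI)
  fix a assume "a \<in> insert e A"
  then show "lpath D a ((f(e := u)) a) ((\<Gamma>(e := q)) a)"
    using F q unfolding path_forest_def by auto
next
  fix a b assume ab: "a \<in> insert e A" "b \<in> insert e A" and ne: "(f(e := u)) a \<noteq> (f(e := u)) b"
    and "\<exists>s. meet a ((f(e := u)) a) ((\<Gamma>(e := q)) a) b ((f(e := u)) b) ((\<Gamma>(e := q)) b) s"
  then obtain s where
    m: "meet a ((f(e := u)) a) ((\<Gamma>(e := q)) a) b ((f(e := u)) b) ((\<Gamma>(e := q)) b) s" by blast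
  consider "a = e" "b = e" | "a = e" "b \<noteq> e" | "a \<noteq> e" "b = e" | "a \<noteq> e" "b \<noteq> e" by blast
  then show False
  proof cases
    case 1
    then show False using ne by simp
  next
    case 2
    then show False using nm[of b s] m ne ab by simp
  next
    case 3
    then show False using nm[of a s] m[unfolded meet_commute[of a]] ne ab by simp
  next
    case 4
    then show False using F ab ne m unfolding path_forest_def by auto
  qed
qed

text \<open>Follow \<open>q\<close> up to its first meeting with the forest and from there the path
  that is met. Before this time nothing is met, and afterwards the new path runs along
  \<open>\<Gamma> i\<close>, which does not meet the other trees.\<close>

lemma attach:
  assumes F: "path_forest D A f \<Gamma>" and e: "e \<notin> A" and q: "lpath D e u q"
  obtains u' \<Gamma>' where "path_forest D (insert e A) (f(e := u')) \<Gamma>'"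
    "u' = u \<or> (\<exists>i\<in>A. u' = f i \<and> (\<exists>s. meet e u q i (f i) (\<Gamma> i) s))"
proof (cases "\<exists>s. \<exists>i\<in>A. meet e u q i (f i) (\<Gamma> i) s")
  case False
  then have "path_forest D (insert e A) (f(e := u)) (\<Gamma>(e := q))"
    using forest_insert[OF F e q] by blast
  then show ?thesis using that by blast
next
  case True
  define s where "s = (LEAST s. \<exists>i\<in>A. meet e u q i (f i) (\<Gamma> i) s)"
  have "\<exists>i\<in>A. meet e u q i (f i) (\<Gamma> i) s" unfolding s_def using LeastI_ex[OF True] .
  then obtain i where i: "i \<in> A" "meet e u q i (f i) (\<Gamma> i) s" by blast
  have first: "\<not> meet e u q l (f l) (\<Gamma> l) t" if "t < s" "l \<in> A" for l t
    using not_less_Least[of t "\<lambda>s. \<exists>i\<in>A. meet e u q i (f i) (\<Gamma> i) s"] that unfolding s_def by blast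
  define q' where "q' = (\<lambda>t. if t \<le> s then q t else \<Gamma> i t)"
  have q': "lpath D e (f i) q'"
    unfolding q'_def using lpath_splice[OF q _ i(2)] F i(1) by (simp add: path_forest_def)
  have nm: False if l: "l \<in> A" "f l \<noteq> f i" and m: "meet e (f i) q' l (f l) (\<Gamma> l) t" for l t
  proof -
    have no: "\<not> meet i (f i) (\<Gamma> i) l (f l) (\<Gamma> l) t" for t
      using F i(1) l unfolding path_forest_def by metis
    consider "t < s" | "t = s" | "s < t" by linarith
    then show False
    proof cases
      case 1
      then have "meet e u q l (f l) (\<Gamma> l) t" using m i(2) by (auto simp: meet_def q'_def)
      then show False using first[OF 1 l(1)] by blast
    next
      case 2
      then show False using m i(2) no[of s] by (auto simp: meet_def q'_def)
    next
      case 3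
      then show False using m i(2) no[of t] by (auto simp: meet_def q'_def)
    qed
  qed
  have "path_forest D (insert e A) (f(e := f i)) (\<Gamma>(e := q'))"
    using forest_insert[OF F e q'] nm by blast
  then show ?thesis using that i by blast
qed

text \<open>The path runs along row \<open>e\<close>, where the column at time \<open>s\<close> is
  \<open>s - e\<close>, turns at the dot at time \<open>e + j\<close>, and goes straight down column
  \<open>j\<close>.\<close>

lemma lpath_hook:
  assumes "(e, j) \<in> D"
  shows "lpath D e j (\<lambda>s. min (s - e) j)"
proof -
  have ej: "e < j" using dot_less assms .
  have "(Suc s - min (Suc s - e) j, min (Suc s - e) j) \<in> D \<or>
     min (Suc (Suc s) - e) j + min (s - e) j = 2 * min (Suc s - e) j"
    if "2 * e \<le> s" for s
  proof -
    have "e \<le> s" using that by linarith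
    consider "Suc s < e + j" | "Suc s = e + j" | "Suc s > e + j" by linarith
    then show ?thesis
      by cases (use that assms in \<open>auto simp: min_def\<close>)
  qed
  moreover have "min (Suc s - e) j = min (s - e) j \<or> min (Suc s - e) j = Suc (min (s - e) j)"
    if "2 * e \<le> s" for s
    using that by (auto simp: min_def)
  moreover have "s < 2 * min (s - e) j" if "2 * e < s" "s < 2 * j" for s
    using that by (auto simp: min_def)
  moreover have "min (2 * e - e) j = e" "min (2 * j - e) j = j"
    using ej by (auto simp: min_def)
  ultimately show ?thesis using ej unfolding lpath_def by blast
qed

text \<open>Disjoint paths are nested or separated, and there is at most one noncrossing matching of given
  sources with given sinks.\<close>

lemma noncrossing_unique:
  assumes F1: "path_forest D A1 f1 \<Gamma>1" "inj_on f1 A1" and F2: "path_forest D A2 f2 \<Gamma>2" "inj_on f2 A2"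
    and A: "\<And>b. k \<le> b \<Longrightarrow> b \<in> A1 \<longleftrightarrow> b \<in> A2"
    and K: "\<And>c. k \<le> c \<Longrightarrow> c \<in> f1 ` A1 \<longleftrightarrow> c \<in> f2 ` A2"
    and b: "b \<in> A1" "k \<le> b"
  shows "f1 b = f2 b"
proof (rule ccontr)
  let ?X = "{b \<in> A1. k \<le> b \<and> f1 b \<noteq> f2 b}"
  assume "f1 b \<noteq> f2 b"
  then have "b \<in> ?X" using b by simp
  moreover have fin: "finite ?X" using forest_rows(2)[OF F1(1)] by simp
  ultimately have M: "Max ?X \<in> ?X" by (intro Max_in) auto
  define m where "m = Max ?X"
  have m: "m \<in> A1" "m \<in> A2" "k \<le> m" "f1 m \<noteq> f2 m" using M A unfolding m_def by auto
  have eq: "f1 l = f2 l" if "l \<in> A1 \<or> l \<in> A2" "m < l" for l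
  proof (rule ccontr)
    assume "f1 l \<noteq> f2 l"
    then have "l \<in> ?X" using that m(3) A[of l] by auto
    then show False using Max_ge[OF fin] that(2) unfolding m_def by fastforce
  qed
  have *: False
    if F1: "path_forest D A1 f1 \<Gamma>1" "inj_on f1 A1" and F2: "path_forest D A2 f2 \<Gamma>2" "inj_on f2 A2"
      and K: "\<And>c. k \<le> c \<Longrightarrow> c \<in> f1 ` A1 \<longleftrightarrow> c \<in> f2 ` A2"
      and A: "\<And>b. k \<le> b \<Longrightarrow> b \<in> A1 \<longleftrightarrow> b \<in> A2"
      and m: "m \<in> A1" "m \<in> A2" "k \<le> m" "f1 m < f2 m"
      and eq: "\<And>l. l \<in> A1 \<or> l \<in> A2 \<Longrightarrow> m < l \<Longrightarrow> f1 l = f2 l" for A1 f1 \<Gamma>1 A2 f2 \<Gamma>2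
  proof -
    \<comment> \<open>The sink \<open>f1 m\<close> is also reached in the second family, say from
      \<open>l\<close>. If \<open>l < m\<close>, then \<open>f2 l < f2 m\<close> contradicts
      nesting; if \<open>m < l\<close>, both families send \<open>l\<close> to \<open>f1 m\<close>,
      against injectivity.\<close>
    have less: "m < f1 m" using forest_less[OF F1(1) m(1)] .
    then obtain l where l: "l \<in> A2" "f2 l = f1 m" using K[of "f1 m"] m(1,3) by auto
    consider "l < m" | "l = m" | "m < l" by linarith
    then show False
    proof cases
      case 1
      then show False using forest_nested(1)[OF F2(1) l(1) m(2)] l(2) m(4) less by auto
    next
      case 2
      then show False using l m by simp
    next
      case 3
      then have "f1 l = f1 m" "l \<in> A1" using eq[of l] l A[of l] m(3) by auto
      then show False using F1(2) m(1) 3 by (auto dest: inj_onD)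
    qed
  qed
  consider "f1 m < f2 m" | "f2 m < f1 m" using m(4) by linarith
  then show False
  proof cases
    case 1
    show False using *[OF F1 F2 K A m(1-3) 1 eq] .
  next
    case 2
    show False using *[OF F2 F1 K[symmetric] A[symmetric] m(2,1,3) 2 eq[symmetric]] by blast
  qed
qed

end

section \<open>Multisets of sinks, and how forests are saturated\<close>

definition sinks :: "nat set \<Rightarrow> (nat \<Rightarrow> nat) \<Rightarrow> nat multiset" where
  "sinks A f = image_mset f (mset_set A)"

lemma sinks_insert: "finite A \<Longrightarrow> e \<notin> A \<Longrightarrow> sinks (insert e A) (f(e := u)) = add_mset u (sinks A f)"
  unfolding sinks_def by (auto intro!: image_mset_cong)

lemma sinks_remove: "finite A \<Longrightarrow> m \<in> A \<Longrightarrow> sinks (A - {m}) f = sinks A f - {#f m#}"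
  unfolding sinks_def by (simp add: mset_set.remove)

lemma size_sinks: "size (sinks A f) = card A"
  by (simp add: sinks_def)

lemma count_sinks: "finite A \<Longrightarrow> count (sinks A f) c = card {i \<in> A. f i = c}"
  unfolding sinks_def by (simp add: count_image_mset sum.If_cases Int_def conj_commute eq_commute)

context le_dots
begin

text \<open>
  If \<open>e\<close> is exchanged for some \<open>j < e\<close>, then the sources below \<open>e\<close> keep their sinks in the new family
  \<open>\<Gamma>2\<close>.  So the trees below \<open>e\<close> can be lowered to lie below the paths of \<open>\<Gamma>2\<close>, and then
  the path of \<open>e\<close> in \<open>\<Gamma>2\<close> avoids them.
\<close>

lemma attach_passive:
  assumes F: "path_forest D A f \<Gamma>" and e: "e \<in> R" "e \<notin> A"
    and pas: "passive_element (forest_bases D R) (base R (leads A f) f) e"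
  obtains u \<Gamma>' m where "path_forest D (insert e A) (f(e := u)) \<Gamma>'" "m \<in> A" "f m = u" "m < e"
proof -
  define S where "S = leads A f"
  define B where "B = base R S f"
  obtain j A2 f2 \<Gamma>2 where j: "j < e" "insert j (B - {e}) = base R A2 f2"
    and F2: "inj_on f2 A2" "path_forest D A2 f2 \<Gamma>2"
    using pas unfolding passive_element_def forest_bases_def B_def S_def by blast
  have SR: "S \<subseteq> R" "A2 \<subseteq> R" "f ` S \<inter> R = {}" "f2 ` A2 \<inter> R = {}"
    using forest_rows(1)[OF F] forest_rows(1)[OF F2(2)] forest_cols[OF F] forest_cols[OF F2(2)]
      leads_subset[of A f] image_leads[of f A] unfolding S_def by auto
  \<comment> \<open>The basis changes only at \<open>e\<close> and \<open>j < e\<close>, so the old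
    and the new family have the same sources and the same sinks among the labels greater than
    \<open>e\<close>.\<close>
  have A2: "b \<in> S \<longleftrightarrow> b \<in> A2" if "Suc e \<le> b" for b
  proof -
    have "b \<in> insert j (B - {e}) \<longleftrightarrow> b \<in> base R A2 f2" using j(2) by simp
    then show ?thesis using that j(1) SR unfolding B_def base_def by auto
  qed
  have K2: "c \<in> f ` S \<longleftrightarrow> c \<in> f2 ` A2" if "Suc e \<le> c" for c
  proof -
    have "c \<in> insert j (B - {e}) \<longleftrightarrow> c \<in> base R A2 f2" using j(2) by simp
    then show ?thesis using that j(1) SR unfolding B_def base_def by auto
  qed
  have eA2: "e \<in> A2"
  proof -
    have "e \<notin> base R A2 f2" using j by auto
    then show ?thesis using e(1) unfolding base_def by auto
  qed
  have same: "b \<in> A2 \<and> f2 b = f b" if "b \<in> S" "e < b" for b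
    using noncrossing_unique[OF forest_leads[OF F] inj_on_leads F2(2,1), folded S_def, OF A2 K2, of b]
      A2[of b] that by auto
  \<comment> \<open>The new sink of \<open>e\<close> is greater than \<open>e\<close>, hence also an
    old sink. Its old lead \<open>s0\<close> lies above \<open>e\<close>, since the leads below
    \<open>e\<close> keep their sinks and \<open>f2\<close> is injective.\<close>
  have "e < f2 e" using forest_less[OF F2(2) eA2] .
  then obtain s0 where s0: "s0 \<in> S" "f s0 = f2 e" using K2[of "f2 e"] eA2 by auto
  have "s0 < e"
  proof (rule ccontr)
    assume "\<not> s0 < e"
    moreover have "s0 \<noteq> e" using s0(1) e(2) leads_subset[of A f] unfolding S_def by auto
    ultimately have "e < s0" by simp
    then have "s0 = e" using same[OF s0(1)] s0(2) F2(1) eA2 by (auto dest: inj_onD)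
    then show False using \<open>s0 \<noteq> e\<close> by simp
  qed
  define ld where "ld i = (SOME m. m \<in> S \<and> f m = f i \<and> m \<le> i)" for i
  have ld: "ld i \<in> S" "f (ld i) = f i" "ld i \<le> i" if "i \<in> A" for i
  proof -
    have "\<exists>m. m \<in> S \<and> f m = f i \<and> m \<le> i" using ex_lead[OF that, of f] unfolding S_def by metis
    from someI_ex[OF this] show "ld i \<in> S" "f (ld i) = f i" "ld i \<le> i" unfolding ld_def by auto
  qed
  have SA: "S \<subseteq> A" unfolding S_def by (rule leads_subset)
  \<comment> \<open>Trees with a lead below \<open>e\<close> are lowered under the new path of their
    lead, which has the same sink; the other trees stay.\<close>
  define \<Delta> where "\<Delta> i = (if e < ld i then (\<lambda>s. min (\<Gamma> i s) (\<Gamma>2 (ld i) s)) else \<Gamma> i)" for i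
  have \<Delta>_le: "\<Delta> i s \<le> \<Gamma> i s" for i s unfolding \<Delta>_def by auto
  \<comment> \<open>If the path of \<open>i\<close> is not lowered, it stays above that of
    \<open>l\<close>, which can only move down. If it is lowered, the lead of \<open>l\<close> lies
    below that of \<open>i\<close>, so \<open>l\<close> is lowered too, and both paths in its
    minimum are below their counterparts for \<open>i\<close>.\<close>
  have nm: False
    if il: "i \<in> A" "l \<in> A" "f i \<noteq> f l" "i < l" and m: "meet i (f i) (\<Delta> i) l (f l) (\<Delta> l) s" for i l s
  proof -
    have s: "2 * l < s" "s < 2 * f i" "s < 2 * f l" "\<Delta> i s = \<Delta> l s" using m by (auto simp: meet_def)
    then have lfi: "l < f i" by linarith
    have less: "f l < f i" "\<Gamma> l s < \<Gamma> i s"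
      using forest_nested(1)[OF F il(1,2,4) lfi il(3)] forest_nested(2)[OF F il(1,2,4) lfi il(3), of s] s
      by auto
    show False
    proof (cases "e < ld i")
      case False
      then show False using less(2) s(4) \<Delta>_le[of l s] unfolding \<Delta>_def[of i] by simp
    next
      case True
      have ldl: "l < f l" using forest_less[OF F il(2)] .
      have "ld i < ld l"
      proof (rule ccontr)
        assume "\<not> ld i < ld l"
        moreover have "ld i \<noteq> ld l" using ld(2)[OF il(1)] ld(2)[OF il(2)] il(3) by auto
        ultimately have "ld l < ld i" by simp
        then have "f (ld i) < f (ld l)"
          using forest_nested(1)[OF F, of "ld l" "ld i"] ld[OF il(1)] ld[OF il(2)] SA il ldl by auto
        then show False using less(1) ld(2)[OF il(1)] ld(2)[OF il(2)] by simp
      qed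
      moreover have "ld l < f2 (ld i)" "f2 (ld i) \<noteq> f2 (ld l)" "s < 2 * f2 (ld l)" "2 * ld l \<le> s"
        using same[OF ld(1)[OF il(1)] True] same[OF ld(1)[OF il(2)]] ld[OF il(1)] ld[OF il(2)]
          calculation True lfi il(3) s by auto
      ultimately have "\<Gamma>2 (ld l) s < \<Gamma>2 (ld i) s"
        using forest_nested(2)[OF F2(2), of "ld i" "ld l" s] same[OF ld(1)[OF il(1)] True]
          same[OF ld(1)[OF il(2)]] True by auto
      then show False
        using less(2) s(4) True \<open>ld i < ld l\<close> unfolding \<Delta>_def by (auto simp: min_def split: if_splits)
    qed
  qed
  have FD: "path_forest D A f \<Delta>"
    unfolding path_forest_def
  proof (intro conjI ballI impI notI)
    fix i assume i: "i \<in> A"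
    have lp: "lpath D i (f i) (\<Gamma> i)" using F i by (simp add: path_forest_def)
    show "lpath D i (f i) (\<Delta> i)"
    proof (cases "e < ld i")
      case True
      then have "lpath D (ld i) (f i) (\<Gamma>2 (ld i))"
        using same[OF ld(1)[OF i]] ld(2)[OF i] F2(2) by (auto simp: path_forest_def)
      then show ?thesis using lpath_min[OF lp _ ld(3)[OF i]] True by (simp add: \<Delta>_def)
    qed (use lp in \<open>simp add: \<Delta>_def\<close>)
  next
    fix i l assume il: "i \<in> A" "l \<in> A" "f i \<noteq> f l"
      and "\<exists>s. meet i (f i) (\<Delta> i) l (f l) (\<Delta> l) s"
    then obtain s where m: "meet i (f i) (\<Delta> i) l (f l) (\<Delta> l) s" by blast
    consider "i < l" | "l < i" using il(3) by (cases i l rule: linorder_cases) auto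
    then show False
    proof cases
      case 1
      then show False using nm[OF il 1 m] by simp
    next
      case 2
      then show False using nm[OF il(2,1) il(3)[symmetric] 2] m[unfolded meet_commute[of i]] by blast
    qed
  qed
  have lpe: "lpath D e (f2 e) (\<Gamma>2 e)" using F2(2) eA2 by (simp add: path_forest_def)
  \<comment> \<open>Either \<open>e\<close> gets the sink of \<open>s0\<close> or it joins a tree.
    The lead of that tree is not below \<open>e\<close>: otherwise the tree would lie under the new
    path of its lead, which is strictly under the new path of \<open>e\<close>.\<close>
  obtain u \<Gamma>' where G: "path_forest D (insert e A) (f(e := u)) \<Gamma>'"
    "u = f2 e \<or> (\<exists>i\<in>A. u = f i \<and> (\<exists>s. meet e (f2 e) (\<Gamma>2 e) i (f i) (\<Delta> i) s))"
    using attach[OF FD e(2) lpe] by blast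
  from G(2) show ?thesis
  proof
    assume "u = f2 e"
    then show ?thesis using that[OF G(1), of s0] s0 SA \<open>s0 < e\<close> by auto
  next
    assume "\<exists>i\<in>A. u = f i \<and> (\<exists>s. meet e (f2 e) (\<Gamma>2 e) i (f i) (\<Delta> i) s)"
    then obtain i s where i: "i \<in> A" "u = f i" "meet e (f2 e) (\<Gamma>2 e) i (f i) (\<Delta> i) s" by blast
    note m = i(3)[unfolded meet_def] and ldi = ld[OF i(1)]
    have "\<not> e < ld i"
    proof
      assume *: "e < ld i"
      have "ld i < f2 e" using m ldi(3) by linarith
      moreover have "f2 e \<noteq> f2 (ld i)"
        using same[OF ldi(1) *] * inj_on_eq_iff[OF F2(1) eA2, of "ld i"] by auto
      ultimately have "\<Gamma>2 (ld i) s < \<Gamma>2 e s"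
        using forest_nested(2)[OF F2(2) eA2, of "ld i" s] same[OF ldi(1) *] ldi * m by auto
      then show False using m * unfolding \<Delta>_def by auto
    qed
    moreover have "ld i \<noteq> e" using ldi(1) SA e(2) by auto
    ultimately show ?thesis using that[OF G(1), of "ld i"] ldi SA i(2) by auto
  qed
qed

text \<open>Attach passive rows one after another. Leads and sinks stay the same, and so does the
  basis, while fewer rows of \<open>R\<close> remain without a path.\<close>

lemma saturate_basis:
  assumes "B \<in> forest_bases D R"
  obtains A f \<Gamma> where "path_forest D A f \<Gamma>" "saturated D R A f" "base R (leads A f) f = B"
proof -
  have *: "\<exists>A f \<Gamma>. path_forest D A f \<Gamma> \<and> saturated D R A f \<and> base R (leads A f) f = B"
    if "path_forest D A f \<Gamma>" "base R (leads A f) f = B" for A f \<Gamma>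
    using that
  proof (induction "card R - card A" arbitrary: A f \<Gamma> rule: less_induct)
    case less
    show ?case
    proof (cases "saturated D R A f")
      case False
      then obtain e where e: "e \<in> R" "e \<notin> A" "passive_element (forest_bases D R) (base R (leads A f) f) e"
        unfolding saturated_def by auto
      obtain u \<Gamma>' m where G: "path_forest D (insert e A) (f(e := u)) \<Gamma>'" "m \<in> A" "f m = u" "m < e"
        using attach_passive[OF less.prems(1) e] .
      have "leads (insert e A) (f(e := u)) = leads A f" using leads_insert[of m A f u e] G(2-4) e(2) by simp
      moreover have "(f(e := u)) ` insert e A = f ` A" using G(2,3) e(2) by auto
      ultimately have "base R (leads (insert e A) (f(e := u))) (f(e := u)) = B"
        using less.prems(2) unfolding base_leads by simp
      moreover have "card (insert e A) \<le> card R" "card (insert e A) = Suc (card A)"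
        using card_mono[OF finite_rows forest_rows(1)[OF G(1)]] forest_rows(2)[OF less.prems(1)] e(2)
        by auto
      ultimately show ?thesis using less.hyps[OF _ G(1)] by auto
    qed (use less in blast)
  qed
  obtain A f \<Gamma> where A: "B = base R A f" "inj_on f A" "path_forest D A f \<Gamma>"
    using assms unfolding forest_bases_def by blast
  have "leads A f = A" using A(2) unfolding leads_def inj_on_def by auto
  then show ?thesis using *[OF A(3)] A(1) that by auto
qed

text \<open>Attach a passive row and drop a higher row of its tree. The multiset of sinks stays the
  same, and the sum of the labels in \<open>A\<close> grows but is bounded by the sum over
  \<open>R\<close>.\<close>

lemma saturate_sinks:
  assumes "path_forest D A0 f0 \<Gamma>0"
  obtains A f \<Gamma> where "path_forest D A f \<Gamma>" "saturated D R A f" "sinks A f = sinks A0 f0"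
proof -
  have "\<exists>A f \<Gamma>. path_forest D A f \<Gamma> \<and> saturated D R A f \<and> sinks A f = sinks A0 f0"
    if "path_forest D A f \<Gamma>" "sinks A f = sinks A0 f0" for A f \<Gamma>
    using that
  proof (induction "\<Sum>R - \<Sum>A" arbitrary: A f \<Gamma> rule: less_induct)
    case less
    show ?case
    proof (cases "saturated D R A f")
      case False
      then obtain e where e: "e \<in> R" "e \<notin> A" "passive_element (forest_bases D R) (base R (leads A f) f) e"
        unfolding saturated_def by auto
      obtain u \<Gamma>' m where G: "path_forest D (insert e A) (f(e := u)) \<Gamma>'" "m \<in> A" "f m = u" "m < e"
        using attach_passive[OF less.prems(1) e] .
      let ?A = "insert e A - {m}"
      have G': "path_forest D ?A (f(e := u)) \<Gamma>'" by (rule forest_subset[OF G(1)]) blast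
      have fin: "finite A" using forest_rows(2)[OF less.prems(1)] .
      have me: "m \<noteq> e" using G(4) by simp
      have "sinks ?A (f(e := u)) = sinks A0 f0"
        using fin G(2,3) me e(2) less.prems(2) by (simp add: sinks_remove sinks_insert)
      moreover have "\<Sum>?A \<le> \<Sum>R"
        using forest_rows(1)[OF G'] finite_rows by (intro sum_mono2) auto
      moreover have "\<Sum>A < \<Sum>?A"
      proof -
        have "\<Sum>?A + m = \<Sum>(insert e A)"
          using sum.remove[of "insert e A" m "\<lambda>x. x"] fin G(2) by simp
        then show ?thesis using fin e(2) G(4) by simp
      qed
      ultimately show ?thesis using less.hyps[OF _ G'] by auto
    qed (use less in blast)
  qed
  from this[OF assms] show ?thesis using that by blast
qed

end

section \<open>Saturated forests\<close>

context le_dots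
begin

text \<open>A sink can be exchanged for the lead of its tree by removing the path of the lead.
  Another row of the tree can be exchanged for the lead by taking its place. Rows without a path are
  excluded by saturation.\<close>

lemma passive_elements:
  assumes F: "path_forest D A f \<Gamma>" and sat: "saturated D R A f"
  shows "{e. passive_element (forest_bases D R) (base R (leads A f) f) e} = f ` A \<union> (A - leads A f)"
proof -
  let ?S = "leads A f" and ?B = "base R (leads A f) f"
  note rows = forest_rows[OF F] and cols = forest_cols[OF F] and SA = leads_subset[of A f]
  have "passive_element (forest_bases D R) ?B e" if e: "e \<in> f ` A \<union> (A - ?S)" for e
  proof -
    have "\<exists>m\<in>?S. m < e \<and> insert m (?B - {e}) \<in> forest_bases D R"
    proof (cases "e \<in> f ` A")
      case True
      then obtain m where m: "m \<in> ?S" "f m = e"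
        using image_leads[of f A] by (metis image_iff)
      have "f ` (?S - {m}) = f ` ?S - {e}"
        using m inj_on_image_set_diff[OF inj_on_leads[of f A], of ?S "{m}"] by simp
      moreover have "R - (?S - {m}) = insert m (R - ?S)" "e \<notin> R" "m \<in> R"
        using m True rows(1) cols SA by auto
      ultimately have "insert m (?B - {e}) = base R (?S - {m}) f"
        unfolding base_def by auto
      moreover have "path_forest D (?S - {m}) f \<Gamma>" using forest_subset[OF F] SA by blast
      moreover have "inj_on f (?S - {m})" by (rule inj_on_subset[OF inj_on_leads]) blast
      moreover have "m < e" using m forest_less[OF F, of m] SA by auto
      ultimately show ?thesis
        using m(1) forest_basesI[of D "?S - {m}" f \<Gamma> R] by metis
    next
      case False
      then have e: "e \<in> A" "e \<notin> ?S" using e by auto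
      obtain m where m: "m \<in> ?S" "f m = f e" "m \<le> e" using ex_lead[OF e(1), of f] by blast
      have me: "m < e" using m e by (cases "m = e") auto
      have img: "f ` (?S - {m}) = f ` ?S - {f e}"
        using m inj_on_image_set_diff[OF inj_on_leads[of f A], of ?S "{m}"] by simp
      have inj: "inj_on f (insert e (?S - {m}))"
        using img inj_on_subset[OF inj_on_leads[of f A], of "?S - {m}"] by auto
      have "f e \<in> f ` ?S" using m(1,2) by (metis imageI)
      then have "f ` insert e (?S - {m}) = f ` ?S" using img by auto
      moreover have "R - insert e (?S - {m}) = insert m (R - ?S - {e})" "m \<in> R" "e \<in> R"
        using m(1) me e(1) rows(1) SA by auto
      moreover have "e \<notin> f ` ?S" using False by (simp add: image_leads)
      ultimately have "insert m (?B - {e}) = base R (insert e (?S - {m})) f"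
        unfolding base_def by auto
      moreover have "path_forest D (insert e (?S - {m})) f \<Gamma>"
        by (rule forest_subset[OF F]) (use SA e in auto)
      ultimately have "insert m (?B - {e}) \<in> forest_bases D R"
        using forest_basesI[of D "insert e (?S - {m})" f \<Gamma> R] inj by simp
      then show ?thesis using me m(1) by blast
    qed
    moreover have "e \<in> ?B" using e rows SA unfolding base_leads by auto
    ultimately show ?thesis unfolding passive_element_def by blast
  qed
  moreover have "e \<in> f ` A \<union> (A - ?S)" if "passive_element (forest_bases D R) ?B e" for e
  proof -
    have "e \<in> (R - ?S) \<union> f ` A" using that unfolding passive_element_def base_leads by simp
    then show ?thesis using that sat unfolding saturated_def by blast
  qed
  ultimately show ?thesis by blast
qed

text \<open>There are as many sinks as leads, so sinks and non-leads together are as many as the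
  rows in \<open>A\<close>.\<close>

lemma card_passive:
  assumes F: "path_forest D A f \<Gamma>" and sat: "saturated D R A f"
  shows "card {e. passive_element (forest_bases D R) (base R (leads A f) f) e} = card A"
proof -
  let ?S = "leads A f"
  note rows = forest_rows[OF F] and cols = forest_cols[OF F] and SA = leads_subset[of A f]
  have "card (f ` A \<union> (A - ?S)) = card (f ` ?S) + card (A - ?S)"
    using rows cols by (subst card_Un_disjoint) (auto simp: image_leads)
  moreover have "card (f ` ?S) = card ?S" by (rule card_image[OF inj_on_leads])
  moreover have "card ?S + card (A - ?S) = card A"
    using card_Un_disjoint[of ?S "A - ?S"] rows(2) SA
    by (metis Diff_disjoint Diff_partition finite_Diff finite_subset)
  ultimately show ?thesis using passive_elements[OF assms] by simp
qed

text \<open>Compare the forests at the largest row \<open>i\<close> where they differ. If both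
  contain \<open>i\<close>, nesting yields opposite inequalities between its two sinks. If only one
  does, basis exchange shows that \<open>i\<close> is passive in the basis of the other, contrary to
  saturation.\<close>

lemma saturated_sinks_unique:
  assumes exch: "\<And>A B a. A \<in> forest_bases D R \<Longrightarrow> B \<in> forest_bases D R \<Longrightarrow> a \<in> A - B \<Longrightarrow>
      \<exists>b\<in>B - A. insert b (A - {a}) \<in> forest_bases D R"
    and F1: "path_forest D A1 f1 \<Gamma>1" "saturated D R A1 f1"
    and F2: "path_forest D A2 f2 \<Gamma>2" "saturated D R A2 f2"
    and eq: "sinks A1 f1 = sinks A2 f2"
  shows "A1 = A2" "i \<in> A1 \<Longrightarrow> f1 i = f2 i"
proof -
  let ?X = "{i \<in> A1 \<union> A2. \<not> (i \<in> A1 \<and> i \<in> A2 \<and> f1 i = f2 i)}"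
  have *: False
    if F1: "path_forest D A1 f1 \<Gamma>1" and F2: "path_forest D A2 f2 \<Gamma>2" "saturated D R A2 f2"
      and eq: "sinks A1 f1 = sinks A2 f2"
      and i: "i \<in> A1" "\<not> (i \<in> A2 \<and> f1 i = f2 i)"
      and above: "\<And>l. i < l \<Longrightarrow> l \<in> A1 \<or> l \<in> A2 \<Longrightarrow> l \<in> A1 \<and> l \<in> A2 \<and> f1 l = f2 l"
    for A1 f1 \<Gamma>1 A2 f2 \<Gamma>2 i
  proof -
    note r1 = forest_rows[OF F1] and r2 = forest_rows[OF F2(1)]
    note c1 = forest_cols[OF F1] and c2 = forest_cols[OF F2(1)]
    have counts: "card {l \<in> A1. f1 l = c} = card {l \<in> A2. f2 l = c}" for c
      using eq count_sinks[OF r1(2)] count_sinks[OF r2(2)] by metis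
    \<comment> \<open>The forests coincide beyond \<open>i\<close>, so each sink is reached equally
      often from the rows \<open>\<le> i\<close> of either forest.\<close>
    have below: "\<exists>l'\<in>B. l' \<le> i \<and> h l' = g l"
      if "A = A1 \<and> g = f1 \<and> B = A2 \<and> h = f2 \<or> A = A2 \<and> g = f2 \<and> B = A1 \<and> h = f1"
        "l \<in> A" "l \<le> i" for A g B h l
    proof (rule ccontr)
      assume no: "\<not> (\<exists>l'\<in>B. l' \<le> i \<and> h l' = g l)"
      have "{l' \<in> B. h l' = g l} \<subseteq> {l' \<in> A. g l' = g l} - {l}"
        using no that above by force
      moreover have fin: "finite {l' \<in> A. g l' = g l}" using r1(2) r2(2) that(1) by auto
      ultimately have "card {l' \<in> B. h l' = g l} \<le> card ({l' \<in> A. g l' = g l} - {l})"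
        by (intro card_mono) auto
      also have "\<dots> < card {l' \<in> A. g l' = g l}"
        using fin that(2) by (intro card_Diff1_less) auto
      finally show False using counts[of "g l"] that(1) by auto
    qed
    obtain i' where i': "i' \<in> A2" "i' \<le> i" "f2 i' = f1 i"
      using below[of A1 f1 A2 f2 i] i(1) by auto
    have less: "i < f1 i" using forest_less[OF F1 i(1)] .
    show False
    proof (cases "i \<in> A2")
      case True
      then have ne: "f1 i \<noteq> f2 i" using i by simp
      then have i'i: "i' < i" using i' by (cases "i' = i") auto
      have "f2 i < f1 i"
        using forest_nested(1)[OF F2(1) i'(1) True i'i] i'(3) less ne by auto
      moreover obtain i'' where i'': "i'' \<in> A1" "i'' \<le> i" "f1 i'' = f2 i"
        using below[of A2 f2 A1 f1 i] True by auto
      moreover have "i'' < i" using i'' ne by (cases "i'' = i") auto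
      ultimately show False
        using forest_nested(1)[OF F1 i''(1) i(1)] forest_less[OF F2(1) True] ne by auto
    next
      case False
      let ?S1 = "leads A1 f1" and ?S2 = "leads A2 f2"
      \<comment> \<open>The path of \<open>i\<close> and those of the first forest's leads below
        \<open>i\<close> give a basis without \<open>i\<close>. Among labels greater than
        \<open>i\<close> it has no element that \<open>?B2\<close> lacks, so exchanging
        \<open>i\<close> in \<open>?B2\<close> brings in some \<open>b < i\<close>.\<close>
      let ?T = "insert i {l \<in> ?S1. i < l}"
      let ?B = "base R ?T f1" and ?B2 = "base R ?S2 f2"
      have TA: "?T \<subseteq> A1" using i(1) leads_subset[of A1 f1] by auto
      have "f1 l \<noteq> f1 i" if "l \<in> ?S1" "i < l" for l
        using that i(1) unfolding leads_def by auto
      then have "f1 i \<notin> f1 ` {l \<in> ?S1. i < l}" by force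
      moreover have "inj_on f1 {l \<in> ?S1. i < l}" by (rule inj_on_subset[OF inj_on_leads]) blast
      ultimately have "inj_on f1 ?T" by auto
      then have "?B \<in> forest_bases D R"
        using forest_basesI[OF forest_subset[OF F1 TA]] by blast
      moreover have "?B2 \<in> forest_bases D R" by (rule base_leads_in[OF F2(1)])
      moreover have "i \<in> ?B2 - ?B"
        using i(1) False r1(1) c1 TA leads_subset[of A2 f2] unfolding base_def by auto
      ultimately obtain b where b: "b \<in> ?B - ?B2" "insert b (?B2 - {i}) \<in> forest_bases D R"
        using exch by blast
      have "\<not> i < b"
      proof
        assume ib: "i < b"
        show False
        proof (cases "b \<in> R")
          case True
          then have bS: "b \<in> ?S2" "b \<notin> ?T" using b(1) TA c1 unfolding base_def by auto
          then have bA: "b \<in> A1" "b \<in> A2" "f1 b = f2 b" using above[OF ib] leads_subset[of A2 f2] by auto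
          \<comment> \<open>A row above \<open>b\<close> with the same sink in the first forest
            would yield one in the second forest, where \<open>b\<close> is a lead. So
            \<open>b\<close> is a lead in both.\<close>
          have "b \<le> l" if l: "l \<in> A1" "f1 l = f1 b" for l
          proof (rule ccontr)
            assume lb: "\<not> b \<le> l"
            obtain l' where "l' \<in> A2" "f2 l' = f2 b" "l' < b"
            proof (cases "i < l")
              case True
              then show ?thesis using that[of l] above[OF True] l lb bA by auto
            next
              case False
              then obtain l' where "l' \<in> A2" "l' \<le> i" "f2 l' = f1 l"
                using below[of A1 f1 A2 f2 l] l by auto
              then show ?thesis using that[of l'] l bA ib by auto
            qed
            then show False using bS(1) unfolding leads_def by auto
          qed
          then have "b \<in> ?S1" using bA(1) unfolding leads_def by auto
          then show False using bS(2) ib by simp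
        next
          case False
          then have "b \<in> f1 ` A1" "b \<notin> f2 ` A2" using b(1) TA unfolding base_def base_leads
            by (auto simp: image_leads)
          moreover have "b \<in># sinks A1 f1 \<longleftrightarrow> b \<in> f1 ` A1" "b \<in># sinks A2 f2 \<longleftrightarrow> b \<in> f2 ` A2"
            using r1(2) r2(2) unfolding sinks_def by auto
          ultimately show False using eq by simp
        qed
      qed
      moreover have "b \<noteq> i" using b(1) \<open>i \<in> ?B2 - ?B\<close> by auto
      ultimately have "passive_element (forest_bases D R) ?B2 i"
        using b(2) \<open>i \<in> ?B2 - ?B\<close> unfolding passive_element_def by (auto intro!: exI[of _ b])
      then show False using F2(2) False i(1) r1(1) unfolding saturated_def by auto
    qed
  qed
  have "?X = {}"
  proof (rule ccontr)
    assume "?X \<noteq> {}"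
    moreover have fin: "finite ?X" using forest_rows(2)[OF F1(1)] forest_rows(2)[OF F2(1)] by auto
    ultimately have "Max ?X \<in> ?X" by (rule Max_in[rotated])
    moreover define i where "i = Max ?X"
    ultimately have i: "i \<in> ?X" by simp
    have above: "l \<in> A1 \<and> l \<in> A2 \<and> f1 l = f2 l" if "i < l" "l \<in> A1 \<or> l \<in> A2" for l
    proof (rule ccontr)
      assume "\<not> ?thesis"
      then have "l \<in> ?X" using that by auto
      then show False using Max_ge[OF fin] that(1) unfolding i_def by fastforce
    qed
    from i consider "i \<in> A1" | "i \<in> A2" by blast
    then show False
    proof cases
      case 1
      show False by (rule *[OF F1(1) F2 eq 1]) (use 1 i above in auto)
    next
      case 2
      show False
        by (rule *[OF F2(1) F1 eq[symmetric] 2]) (use 2 i above[THEN conjunct1] above[THEN conjunct2] in auto)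
    qed
  qed
  then show "A1 = A2" "i \<in> A1 \<Longrightarrow> f1 i = f2 i" by auto
qed

text \<open>The basis determines the leads and the set of sinks, and its passive elements determine
  the other rows of the forest. The sinks of the leads follow from
  \<open>noncrossing_unique\<close>, those of the other rows from nesting.\<close>

lemma saturated_base_unique:
  assumes F1: "path_forest D A1 f1 \<Gamma>1" "saturated D R A1 f1"
    and F2: "path_forest D A2 f2 \<Gamma>2" "saturated D R A2 f2"
    and eq: "base R (leads A1 f1) f1 = base R (leads A2 f2) f2"
  shows "sinks A1 f1 = sinks A2 f2"
proof -
  note r1 = forest_rows[OF F1(1)] and r2 = forest_rows[OF F2(1)]
  note c1 = forest_cols[OF F1(1)] and c2 = forest_cols[OF F2(1)]
  note S1 = leads_subset[of A1 f1] and S2 = leads_subset[of A2 f2]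
  have S: "leads A1 f1 = leads A2 f2" and K: "f1 ` A1 = f2 ` A2"
  proof -
    have "R - leads A f = base R (leads A f) f \<inter> R" "f ` A = base R (leads A f) f - R"
      if "f ` A \<inter> R = {}" for A f
      using that unfolding base_leads by blast+
    note * = this[OF c1] this[OF c2]
    show "f1 ` A1 = f2 ` A2" using * eq by simp
    have "R - leads A1 f1 = R - leads A2 f2" using * eq by simp
    moreover have "leads A1 f1 \<subseteq> R" "leads A2 f2 \<subseteq> R" using S1 S2 r1(1) r2(1) by auto
    ultimately show "leads A1 f1 = leads A2 f2" by blast
  qed
  have "f1 ` A1 \<union> (A1 - leads A1 f1) = f2 ` A2 \<union> (A2 - leads A2 f2)"
    using passive_elements[OF F1] passive_elements[OF F2] eq by simp
  then have "A1 - leads A1 f1 = A2 - leads A2 f2" using r1(1) r2(1) c1 c2 by blast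
  then have A: "A1 = A2" using S S1 S2 by blast
  have K': "f1 ` leads A1 f1 = f2 ` leads A2 f2" using K by (simp only: image_leads)
  have lead: "f1 b = f2 b" if "b \<in> leads A1 f1" for b
  proof (rule noncrossing_unique[OF forest_leads[OF F1(1)] inj_on_leads
        forest_leads[OF F2(1)] inj_on_leads, where k = 0])
    show "x \<in> leads A1 f1 \<longleftrightarrow> x \<in> leads A2 f2" for x by (subst S) (rule refl)
    show "x \<in> f1 ` leads A1 f1 \<longleftrightarrow> x \<in> f2 ` leads A2 f2" for x by (subst K') (rule refl)
  qed (use that in auto)
  \<comment> \<open>The lead \<open>m\<close> of the tree of \<open>e\<close> in the first forest
    has the same sink \<open>f1 e\<close> in the second. As \<open>m < e < f2 m\<close>, nesting in
    the second forest forces \<open>f2 e < f1 e\<close>.\<close>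
  have *: False
    if F1: "path_forest D A1 f1 \<Gamma>1" and F2: "path_forest D A1 f2 \<Gamma>2" and e: "e \<in> A1" "f1 e < f2 e"
      and lead: "\<And>b. b \<in> leads A1 f1 \<Longrightarrow> f1 b = f2 b" for f1 f2 \<Gamma>1 \<Gamma>2 e
  proof -
    obtain m where m: "m \<in> leads A1 f1" "f1 m = f1 e" "m \<le> e" using ex_lead[OF e(1)] .
    then have "m \<in> A1" "f2 m = f1 e" "m < e"
      using lead[OF m(1)] leads_subset[of A1 f1] e(2) by (auto simp: le_less)
    then show False
      using forest_nested(1)[OF F2, of m e] forest_less[OF F1 e(1)] e by auto
  qed
  have "f1 e = f2 e" if e: "e \<in> A1" for e
  proof (rule ccontr)
    assume "f1 e \<noteq> f2 e"
    then consider "f1 e < f2 e" | "f2 e < f1 e" by linarith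
    then show False
    proof cases
      case 1
      then show False using *[OF F1(1) _ e] F2(1) A lead by blast
    next
      case 2
      have "b \<in> leads A1 f2 \<Longrightarrow> f2 b = f1 b" for b using lead S A by auto
      then show False using *[OF _ F1(1) e] 2 F2(1) A by blast
    qed
  qed
  then show ?thesis unfolding sinks_def A[symmetric]
    using forest_rows(2)[OF F1(1)] by (auto intro!: image_mset_cong)
qed

end

section \<open>The order ideal of sinks\<close>

lemma strip_while_map_upt:
  assumes "a \<le> b" "\<And>i. a \<le> i \<Longrightarrow> h i = (0 :: nat)"
  shows "strip_while (\<lambda>x. x = 0) (map h [0..<b]) = strip_while (\<lambda>x. x = 0) (map h [0..<a])"
  using assms(1) by (induction b rule: dec_induct) (simp_all add: assms(2))

lemma eq_up_to_trailing_zeros_map: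
  assumes "\<And>i. a \<le> i \<Longrightarrow> h i = 0" "\<And>i. b \<le> i \<Longrightarrow> h i = 0"
  shows "eq_up_to_trailing_zeros (map h [0..<a]) (map h [0..<b])"
  unfolding eq_up_to_trailing_zeros_def
  using strip_while_map_upt[of a b h] strip_while_map_upt[of b a h] assms by (metis linear)

definition sink_ideal :: "(nat \<times> nat) set \<Rightarrow> nat multiset set" where
  "sink_ideal D = {sinks A f | A f. \<exists>\<Gamma>. path_forest D A f \<Gamma>}"

lemma sink_idealI: "path_forest D A f \<Gamma> \<Longrightarrow> sinks A f \<in> sink_ideal D"
  unfolding sink_ideal_def by blast

context le_dots
begin

lemma finite_forest_bases: "finite (forest_bases D R)"
proof (rule finite_subset)
  show "forest_bases D R \<subseteq> Pow (R \<union> snd ` D)"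
    unfolding forest_bases_def base_def path_forest_def using lpath_col by fastforce
qed (use finite_rows finite_dots in auto)

lemma card_base:
  assumes "B \<in> forest_bases D R"
  shows "finite B" "card B = card R"
proof -
  obtain A f \<Gamma> where B: "B = base R A f" "inj_on f A" "path_forest D A f \<Gamma>"
    using assms unfolding forest_bases_def by blast
  note r = forest_rows[OF B(3)] and c = forest_cols[OF B(3)]
  show "finite B" using B(1) r(2) finite_rows unfolding base_def by simp
  have "card B = card (R - A) + card (f ` A)"
    unfolding B(1) base_def using r c finite_rows by (intro card_Un_disjoint) auto
  then show "card B = card R"
    using card_image[OF B(2)] card_Diff_subset[OF r(2,1)] card_mono[OF finite_rows r(1)] by simp
qed

lemma forest_empty: "path_forest D {} f \<Gamma>"
  by (simp add: path_forest_def)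

text \<open>Dropping paths leaves a forest, so it suffices to realize a submultiset of the sinks by
  a subset of the rows.\<close>

lemma sink_ideal_downward:
  assumes "M \<in> sink_ideal D" "N \<subseteq># M"
  shows "N \<in> sink_ideal D"
proof -
  obtain A f \<Gamma> where A: "M = sinks A f" "path_forest D A f \<Gamma>"
    using assms(1) unfolding sink_ideal_def by blast
  have "\<exists>A'\<subseteq>A. N = sinks A' f" if "finite A" "N \<subseteq># sinks A f" for A N
    using that
  proof (induction A arbitrary: N rule: finite_induct)
    case (insert a A)
    have s: "sinks (insert a A) f = add_mset (f a) (sinks A f)"
      using sinks_insert[OF insert.hyps, of f "f a"] by simp
    show ?case
    proof (cases "f a \<in># N")
      case True
      then have "N - {#f a#} \<subseteq># sinks A f" using insert.prems s
        by (metis insert_DiffM mset_subset_eq_add_mset_cancel)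
      then obtain A' where A': "A' \<subseteq> A" "N - {#f a#} = sinks A' f" using insert.IH by blast
      have "sinks (insert a A') f = add_mset (f a) (sinks A' f)"
        using sinks_insert[of A' a f "f a"] A'(1) insert.hyps finite_subset by auto
      then have "N = sinks (insert a A') f" using A'(2) True by (metis insert_DiffM)
      then show ?thesis using A'(1) by blast
    next
      case False
      then have "N \<subseteq># sinks A f" using insert.prems s
        by (metis Diff_eq_empty_iff_mset add_mset_add_single diff_union_swap2 minus_add_mset_if_not_in_lhs)
      then show ?thesis using insert.IH by blast
    qed
  qed (simp add: sinks_def)
  from this[OF forest_rows(2)[OF A(2)]] obtain A' where "A' \<subseteq> A" "N = sinks A' f"
    using assms(2) A(1) by blast
  then show ?thesis using forest_subset[OF A(2)] unfolding sink_ideal_def by blast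
qed

text \<open>Every path starts in a row with a dot. Conversely, a row with a dot but without a path
  could be attached along a hook, contrary to maximality.\<close>

lemma maximal_sinks:
  assumes "maximal_monomial (sink_ideal D) M"
  shows "size M = card (fst ` D)"
proof -
  obtain A f \<Gamma> where A: "M = sinks A f" "path_forest D A f \<Gamma>"
    using assms unfolding maximal_monomial_def sink_ideal_def by blast
  have "A \<subseteq> fst ` D" using A(2) unfolding path_forest_def using lpath_row by blast
  moreover have "e \<in> A" if ej: "(e, j) \<in> D" for e j
  proof (rule ccontr)
    assume e: "e \<notin> A"
    obtain u \<Gamma>' where F: "path_forest D (insert e A) (f(e := u)) \<Gamma>'"
      using attach[OF A(2) e lpath_hook[OF ej]] by blast
    have N: "sinks (insert e A) (f(e := u)) = add_mset u M"
      using sinks_insert[OF forest_rows(2)[OF A(2)] e] A(1) by simp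
    have "sinks (insert e A) (f(e := u)) \<in> sink_ideal D"
      by (rule sink_idealI[OF F])
    moreover have "M \<subseteq># sinks (insert e A) (f(e := u))" unfolding N by simp
    ultimately have "sinks (insert e A) (f(e := u)) = M"
      using assms unfolding maximal_monomial_def by blast
    then have "size (add_mset u M) = size M" unfolding N by (rule arg_cong)
    then show False by simp
  qed
  ultimately have "A = fst ` D" by force
  then show ?thesis using A(1) size_sinks by simp
qed

text \<open>A basis and a monomial correspond if they belong to a common saturated forest. The two
  saturation lemmas give each a partner, and the two uniqueness lemmas give only one; the exchange
  property enters where the monomial determines the basis.\<close>

lemma bij_bases_sinks:
  assumes exch: "\<And>A B a. A \<in> forest_bases D R \<Longrightarrow> B \<in> forest_bases D R \<Longrightarrow> a \<in> A - B \<Longrightarrow>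
      \<exists>b\<in>B - A. insert b (A - {a}) \<in> forest_bases D R"
  obtains g where "bij_betw g (forest_bases D R) (sink_ideal D)"
    "\<And>B. B \<in> forest_bases D R \<Longrightarrow> size (g B) = card {e. passive_element (forest_bases D R) B e}"
proof -
  define rel where "rel B M \<longleftrightarrow> (\<exists>A f \<Gamma>. path_forest D A f \<Gamma> \<and> saturated D R A f \<and>
    base R (leads A f) f = B \<and> sinks A f = M)" for B M
  define g where "g B = (SOME M. rel B M)" for B
  have g: "rel B (g B)" if "B \<in> forest_bases D R" for B
    unfolding g_def rel_def by (rule someI_ex) (metis saturate_basis[OF that])
  have g_eq: "g B = M" if "rel B M" for B M
  proof -
    have "B \<in> forest_bases D R" using that base_leads_in unfolding rel_def by blast
    then show ?thesis using g[of B] that saturated_base_unique unfolding rel_def by metis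
  qed
  have unique: "B = B'" if B: "rel B M" "rel B' M" for B B' M
  proof -
    obtain A f \<Gamma> A' f' \<Gamma>' where F: "path_forest D A f \<Gamma>" "saturated D R A f" "base R (leads A f) f = B"
        "path_forest D A' f' \<Gamma>'" "saturated D R A' f'" "base R (leads A' f') f' = B'" "sinks A f = sinks A' f'"
      using B unfolding rel_def by metis
    note AA' = saturated_sinks_unique[OF exch F(1,2,4,5,7)]
    have "A' = A" using AA'(1) by simp
    then have "leads A f = leads A' f'" "f ` A = f' ` A'" using AA'(2) by (auto simp: leads_def)
    then show ?thesis using F(3,6) unfolding base_leads by simp
  qed
  have "g B \<in> sink_ideal D" if "B \<in> forest_bases D R" for B
    using g[OF that] sink_idealI unfolding rel_def by metis
  moreover have "M \<in> g ` forest_bases D R" if M: "M \<in> sink_ideal D" for M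
  proof -
    obtain A0 f0 \<Gamma>0 where "M = sinks A0 f0" "path_forest D A0 f0 \<Gamma>0"
      using M unfolding sink_ideal_def by blast
    then obtain A f \<Gamma> where A: "path_forest D A f \<Gamma>" "saturated D R A f" "sinks A f = M"
      using saturate_sinks by metis
    then have "g (base R (leads A f) f) = M" using g_eq unfolding rel_def by blast
    then show ?thesis using base_leads_in[OF A(1)] by blast
  qed
  moreover have "inj_on g (forest_bases D R)"
    using g unique by (metis inj_onI)
  ultimately have "bij_betw g (forest_bases D R) (sink_ideal D)" unfolding bij_betw_def by blast
  moreover have "size (g B) = card {e. passive_element (forest_bases D R) B e}"
    if "B \<in> forest_bases D R" for B
    using g[OF that] card_passive size_sinks unfolding rel_def by metis
  ultimately show ?thesis using that by blast
qed

lemma pure_O_sequence_forest_bases: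
  assumes "matroid E (forest_bases D R)"
  shows "pure_O_sequence (h_vector (forest_bases D R))"
proof -
  let ?B = "forest_bases D R" and ?X = "sink_ideal D"
  have "\<exists>b\<in>B - A. insert b (A - {a}) \<in> ?B" if "A \<in> ?B" "B \<in> ?B" "a \<in> A - B" for A B a
    using assms that unfolding matroid_def by blast
  then obtain g where g: "bij_betw g ?B ?X"
    "\<And>B. B \<in> ?B \<Longrightarrow> size (g B) = card {e. passive_element ?B B e}"
    using bij_bases_sinks by blast
  have fin: "finite ?X" using g(1) finite_forest_bases bij_betw_finite by blast
  have h: "h_number ?B i = card {M \<in> ?X. size M = i}" for i
  proof -
    have "?X = g ` ?B" "inj_on g ?B" using g(1) unfolding bij_betw_def by auto
    moreover from this have "{M \<in> ?X. size M = i} = g ` {B \<in> ?B. size (g B) = i}" by auto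
    moreover have "{B \<in> ?B. size (g B) = i} = {B \<in> ?B. card {e. passive_element ?B B e} = i}"
      using g(2) by auto
    ultimately show ?thesis
      unfolding h_number_def by (metis (no_types, lifting) card_image inj_on_subset mem_Collect_eq subsetI)
  qed
  have ne: "?X \<noteq> {}" "?B \<noteq> {}"
    using sink_idealI[OF forest_empty] forest_basesI[OF forest_empty inj_on_empty] by blast+
  have "order_ideal ?X"
    using fin ne sink_ideal_downward unfolding order_ideal_def by blast
  moreover have "pure_ideal ?X" unfolding pure_ideal_def using maximal_sinks by metis
  moreover have "eq_up_to_trailing_zeros (h_vector ?B) (O_sequence ?X)"
  proof -
    \<comment> \<open>Both lists are values of \<open>h_number\<close>, cut off at the rank and at
      the maximal degree respectively; it vanishes beyond either bound.\<close>
    have rank: "matroid_rank ?B = card R"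
      unfolding matroid_rank_def using ne(2) card_base(2) by (intro the_equality) auto
    have "h_number ?B i = 0" if "Suc (card R) \<le> i" for i
    proof -
      have "card {e. passive_element ?B B e} \<le> card R" if "B \<in> ?B" for B
        using card_mono[OF card_base(1)[OF that], of "{e. passive_element ?B B e}"] card_base(2)[OF that]
        unfolding passive_element_def by auto
      then have "{B \<in> ?B. card {e. passive_element ?B B e} = i} = {}" using that by fastforce
      then show ?thesis unfolding h_number_def by (simp only: card.empty)
    qed
    moreover have "h_number ?B i = 0" if "Suc (Max (size ` ?X)) \<le> i" for i
    proof -
      have "size M \<le> Max (size ` ?X)" if "M \<in> ?X" for M using fin that by simp
      then have "{M \<in> ?X. size M = i} = {}" using that by fastforce
      then show ?thesis unfolding h by (simp only: card.empty)
    qed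
    ultimately show ?thesis
      unfolding h_vector_def O_sequence_def rank h[symmetric]
      by (rule eq_up_to_trailing_zeros_map)
  qed
  ultimately show ?thesis unfolding pure_O_sequence_def by blast
qed

end

section \<open>Paths of the Le-graph\<close>

fun vertex_time :: "le_vertex \<Rightarrow> nat" where
  "vertex_time (Boundary m) = 2 * m"
| "vertex_time (Dot i j) = i + j"

fun vertex_col :: "le_vertex \<Rightarrow> nat" where
  "vertex_col (Boundary m) = m"
| "vertex_col (Dot i j) = j"

section \<open>From lattice paths to walks in the Le-graph\<close>

context le_dots
begin

text \<open>If the earliest meeting were not at a dot, the paths would agree one step before. That
  would be an earlier meeting, unless it is the source of one path; but there the other path, having
  another source, is elsewhere.\<close>

lemma meet_at_dot:
  assumes lp: "lpath D b c J" "lpath D b' c' J'" and ne: "b \<noteq> b'" and m: "meet b c J b' c' J' s"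
  obtains s' where "meet b c J b' c' J' s'" "(s' - J s', J s') \<in> D"
proof -
  define t where "t = (LEAST s. meet b c J b' c' J' s)"
  have t: "meet b c J b' c' J' t" unfolding t_def using LeastI[of "meet b c J b' c' J'" s] m by blast
  have no: "\<not> meet b c J b' c' J' (t - 1)"
  proof (rule not_less_Least)
    show "t - 1 < (LEAST s. meet b c J b' c' J' s)"
      unfolding t_def[symmetric] using t by (simp add: meet_def)
  qed
  have "(t - J t, J t) \<in> D"
  proof (rule ccontr)
    assume "(t - J t, J t) \<notin> D"
    then have eq: "J (t - 1) = J' (t - 1)" using no_crossing(2)[OF lp t] by simp
    then have "t - 1 = 2 * b \<or> t - 1 = 2 * b'" using no t unfolding meet_def by auto
    then show False
      using eq ne t lpathD(2)[OF lp(1)] lpathD(2)[OF lp(2)] lpathD(5)[OF lp(1), of "2 * b'"]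
        lpathD(5)[OF lp(2), of "2 * b"] unfolding meet_def by (cases "b < b'") auto
  qed
  then show ?thesis using that t by blast
qed

text \<open>A path is straight between dots. A horizontal run ends at a dot because the last step of
  the path is vertical, and a vertical run does not begin at the source because the first step is
  horizontal.\<close>

lemma next_dot:
  assumes lp: "lpath D b c J" and s: "2 * b \<le> s" "s < 2 * c"
  obtains t where "s < t" "t \<le> 2 * c" "t = 2 * c \<or> (t - J t, J t) \<in> D"
    "\<And>r. s < r \<Longrightarrow> r < t \<Longrightarrow> (r - J r, J r) \<notin> D"
    "(\<forall>r. s < r \<and> r \<le> t \<longrightarrow> J r = J s + (r - s)) \<and> t < 2 * c \<or> (\<forall>r. s < r \<and> r \<le> t \<longrightarrow> J r = J s) \<and> 2 * b < s"
proof -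
  define t where "t = (LEAST t. s < t \<and> (t = 2 * c \<or> (t - J t, J t) \<in> D))"
  have t: "s < t \<and> (t = 2 * c \<or> (t - J t, J t) \<in> D)"
    unfolding t_def by (rule LeastI[of _ "2 * c"]) (use s in simp)
  have tc: "t \<le> 2 * c" unfolding t_def by (rule Least_le) (use s in simp)
  have nd: "(r - J r, J r) \<notin> D" if "s < r" "r < t" for r
    using not_less_Least[of r "\<lambda>t. s < t \<and> (t = 2 * c \<or> (t - J t, J t) \<in> D)"] that
    unfolding t_def[symmetric] by auto
  have straight: "J (Suc r) + J s = J r + J (Suc s)" if "s \<le> r" "r < t" for r
    using that
  proof (induction r rule: dec_induct)
    case (step r)
    then have "J (Suc (Suc r)) + J r = 2 * J (Suc r)"
      using lpathD(6)[OF lp, of r] nd[of "Suc r"] s tc by auto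
    then show ?case using step by auto
  qed auto
  consider "J (Suc s) = Suc (J s)" | "J (Suc s) = J s" using lpathD(4)[OF lp s] by blast
  then show ?thesis
  proof cases
    case 1
    have *: "J r = J s + (r - s)" if "s \<le> r" "r \<le> t" for r
      using that
    proof (induction r rule: dec_induct)
      case (step r)
      then show ?case using straight[of r] 1 by auto
    qed simp
    have "t \<noteq> 2 * c"
    proof
      assume tt: "t = 2 * c"
      have "J (Suc (2 * c - 1)) = Suc (J (2 * c - 1))"
        using straight[of "2 * c - 1"] 1 s tt by auto
      then show False using lpath_last(1)[OF lp] lpathD(3)[OF lp] s by auto
    qed
    moreover have "\<forall>r. s < r \<and> r \<le> t \<longrightarrow> J r = J s + (r - s)" by (blast intro: * less_imp_le)
    ultimately show ?thesis using that[of t] t tc nd by (metis le_neq_implies_less)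
  next
    case 2
    have *: "J r = J s" if "s \<le> r" "r \<le> t" for r
      using that
    proof (induction r rule: dec_induct)
      case (step r)
      then have "J r = J s" by simp
      then show ?case using straight[of r] 2 step.hyps step.prems by linarith
    qed simp
    have "s \<noteq> 2 * b" using 2 lpath_last(3)[OF lp] lpathD(2)[OF lp] by auto
    then have "2 * b < s" using s by simp
    moreover have "\<forall>r. s < r \<and> r \<le> t \<longrightarrow> J r = J s" by (blast intro: * less_imp_le)
    ultimately show ?thesis using that[of t] t tc nd by blast
  qed
qed

text \<open>Each straight run up to the next dot or the sink is one arc; \<open>v\<close> is the
  vertex reached at time \<open>s\<close>. The vertices are distinct because time increases along
  the walk. The bound on \<open>set p\<close> later gives disjointness.\<close>

lemma lpath_walk:
  assumes lp: "lpath D b c J"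
  shows "2 * b \<le> s \<Longrightarrow> s < 2 * c \<Longrightarrow>
    s = 2 * b \<and> v = Boundary b \<or> 2 * b < s \<and> (s - J s, J s) \<in> D \<and> v = Dot (s - J s) (J s) \<Longrightarrow>
    \<exists>p. p \<noteq> [] \<and> last p = Boundary c \<and> set (vwalk_arcs (v # p)) \<subseteq> le_arcs D \<and> distinct p \<and>
      set p \<subseteq> insert (Boundary c) {Dot i j | i j. (i, j) \<in> D \<and> J (i + j) = j \<and> s < i + j \<and> i + j < 2 * c}"
proof (induction "2 * c - s" arbitrary: s v rule: less_induct)
  case less
  note s = less.prems(1,2)
  obtain t where t: "s < t" "t \<le> 2 * c" "t = 2 * c \<or> (t - J t, J t) \<in> D"
    and nd: "\<And>r. s < r \<Longrightarrow> r < t \<Longrightarrow> (r - J r, J r) \<notin> D"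
    and dir: "(\<forall>r. s < r \<and> r \<le> t \<longrightarrow> J r = J s + (r - s)) \<and> t < 2 * c \<or> (\<forall>r. s < r \<and> r \<le> t \<longrightarrow> J r = J s) \<and> 2 * b < s"
    using next_dot[OF lp s] by blast
  have Js: "J s \<le> s" using lpath_bounds(2)[OF lp s(1)] s(2) by simp
  define w where "w = (if t = 2 * c then Boundary c else Dot (t - J t) (J t))"
  have arc: "(v, w) \<in> le_arcs D"
    using dir
  proof
    assume *: "(\<forall>r. s < r \<and> r \<le> t \<longrightarrow> J r = J s + (r - s)) \<and> t < 2 * c"
    then have Jt: "J t = J s + (t - s)" and tc: "t < 2 * c" using t(1) by auto
    then have tD: "(s - J s, J t) \<in> D" and w: "w = Dot (s - J s) (J t)"
      using t Js unfolding w_def by (auto simp: algebra_simps)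
    have none: "(s - J s, l) \<notin> D" if "J s < l" "l < J t" for l
    proof -
      have r: "s < s - J s + l" "s - J s + l < t" using that Jt Js by auto
      then have "J (s - J s + l) = l" using * that Js by auto
      then show ?thesis using nd[OF r] by auto
    qed
    from less.prems(3) show ?thesis
    proof
      assume v: "s = 2 * b \<and> v = Boundary b"
      \<comment> \<open>Row \<open>b\<close> has no dots in columns \<open>\<le> b\<close>, so the
        dot that is reached is the first one in this row.\<close>
      then have "(b, l) \<notin> D" if "l < J t" for l
        using none[of l] that dot_less[of b l] lpathD(2)[OF lp] by (cases "b < l") auto
      moreover have "s - J s = b" using v lpathD(2)[OF lp] by auto
      ultimately show ?thesis using v w tD le_arcs.left_boundary[of b "J t" D] by auto
    next
      assume v: "2 * b < s \<and> (s - J s, J s) \<in> D \<and> v = Dot (s - J s) (J s)"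
      then show ?thesis
        unfolding w using le_arcs.left_dot[OF tD, of "J s"] none Jt t(1) by auto
    qed
  next
    assume *: "(\<forall>r. s < r \<and> r \<le> t \<longrightarrow> J r = J s) \<and> 2 * b < s"
    then have v: "(s - J s, J s) \<in> D" "v = Dot (s - J s) (J s)" and Jt: "J t = J s"
      using less.prems(3) t(1) by auto
    have none: "(l, J s) \<notin> D" if "s - J s < l" "l + J s < t" for l
    proof -
      have r: "s < l + J s" using that Js by auto
      then have "J (l + J s) = J s" using * that by auto
      then show ?thesis using nd[OF r that(2)] by auto
    qed
    show ?thesis
    proof (cases "t = 2 * c")
      case True
      then have "J s = c" using Jt lpathD(3)[OF lp] by simp
      moreover have "(l, J s) \<notin> D" if "s - J s < l" for l
        using none[OF that] dot_less[of l "J s"] True calculation by (cases "l < J s") auto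
      ultimately show ?thesis using v True unfolding w_def
        using le_arcs.down_boundary[of "s - J s" "J s" D] by auto
    next
      case False
      then have tD: "(t - J s, J s) \<in> D" and w: "w = Dot (t - J s) (J s)"
        using t Jt unfolding w_def by auto
      show ?thesis unfolding w v(2)
        by (rule le_arcs.down_dot[OF v(1) tD]) (use t(1) Js none in \<open>auto simp: less_diff_conv\<close>)
    qed
  qed
  show ?case
  proof (cases "t = 2 * c")
    case True
    then show ?thesis using arc unfolding w_def by (intro exI[of _ "[Boundary c]"]) auto
  next
    case False
    then have tc: "t < 2 * c" and wD: "(t - J t, J t) \<in> D" "w = Dot (t - J t) (J t)"
      using t unfolding w_def by auto
    have Jt: "J t \<le> t" using lpath_bounds(2)[OF lp, of t] s t by simp
    have "2 * c - t < 2 * c - s" "2 * b \<le> t" "2 * b < t" using tc t(1) s by auto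
    from less.hyps[OF this(1,2) tc, of w] this(3) wD
    obtain p where p: "p \<noteq> []" "last p = Boundary c" "set (vwalk_arcs (w # p)) \<subseteq> le_arcs D" "distinct p"
      "set p \<subseteq> insert (Boundary c) {Dot i j | i j. (i, j) \<in> D \<and> J (i + j) = j \<and> t < i + j \<and> i + j < 2 * c}"
      by blast
    have "w \<notin> set p" using p(5) wD(2) Jt by auto
    moreover have "set (w # p) \<subseteq> insert (Boundary c)
        {Dot i j | i j. (i, j) \<in> D \<and> J (i + j) = j \<and> s < i + j \<and> i + j < 2 * c}"
      using p(5) wD Jt tc t(1) by fastforce
    ultimately show ?thesis
      using p arc by (intro exI[of _ "w # p"]) auto
  qed
qed

end

section \<open>From walks in the Le-graph to lattice paths\<close>

text \<open>Turning is not restricted at the first time, so that an arc can be prepended.\<close>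

definition lpath_from ::
  "(nat \<times> nat) set \<Rightarrow> le_vertex list \<Rightarrow> nat \<Rightarrow> (nat \<Rightarrow> nat) \<Rightarrow> bool" where
  "lpath_from D p c J \<longleftrightarrow> (let s0 = vertex_time (hd p) in
     s0 \<le> 2 * c \<and> J s0 = vertex_col (hd p) \<and> J (2 * c) = c \<and>
     (\<forall>s. s0 \<le> s \<and> s < 2 * c \<longrightarrow> J (Suc s) = J s \<or> J (Suc s) = Suc (J s)) \<and>
     (\<forall>s. s0 < s \<and> s < 2 * c \<longrightarrow> s < 2 * J s) \<and>
     (\<forall>s. s0 \<le> s \<and> Suc (Suc s) \<le> 2 * c \<and> (Suc s - J (Suc s), J (Suc s)) \<notin> D \<longrightarrow>
        J (Suc (Suc s)) + J s = 2 * J (Suc s)) \<and>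
     (\<forall>s. s0 \<le> s \<and> s < 2 * c \<and> (s - J s, J s) \<in> D \<longrightarrow> Dot (s - J s) (J s) \<in> set p))"

context le_dots
begin

text \<open>The boundary vertex \<open>m\<close> counts as the point \<open>(m, m)\<close>, so that
  arcs at the boundary share a case with arcs between dots.\<close>

lemma arc_cases:
  assumes "(u, v) \<in> le_arcs D"
  obtains (horizontal) i j' j where "j' < j" "i \<le> j'" "(i, j) \<in> D" "v = Dot i j"
      "u = Dot i j' \<or> u = Boundary i \<and> i = j'" "\<And>l. j' < l \<Longrightarrow> l < j \<Longrightarrow> (i, l) \<notin> D"
  | (vertical) i j i' where "i < i'" "i' \<le> j" "(i, j) \<in> D" "u = Dot i j"
      "v = Dot i' j \<and> (i', j) \<in> D \<or> v = Boundary j \<and> i' = j" "\<And>l. i < l \<Longrightarrow> l < i' \<Longrightarrow> (l, j) \<notin> D"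
  using assms
proof cases
  case (left_dot i j j')
  then show ?thesis using horizontal[of j' j i] dot_less[of i j'] by auto
next
  case (left_boundary i j)
  then show ?thesis using horizontal[of i j i] dot_less[of i j] by auto
next
  case (down_dot i j i')
  then show ?thesis using vertical[of i i' j] dot_less[of i' j] by auto
next
  case (down_boundary i j)
  then show ?thesis using vertical[of i j j] dot_less[of i j] by auto
qed

text \<open>The arc becomes a straight run in front of the path: in row \<open>i\<close> the column
  at time \<open>s\<close> is \<open>s - i\<close>, in column \<open>j\<close> it is constant. A
  turn at the joint is allowed because there is a dot, unless the path ends there. Inside the run
  there are no dots.\<close>

lemma lpath_from_Cons:
  assumes q: "lpath_from D p c J" and p: "p \<noteq> []" and arc: "(u, hd p) \<in> le_arcs D"
    and hd: "\<And>m. hd p = Boundary m \<Longrightarrow> m = c"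
  shows "\<exists>J'. lpath_from D (u # p) c J'"
proof -
  define s0 where "s0 = vertex_time (hd p)"
  note J = q[unfolded lpath_from_def Let_def, folded s0_def]
  from arc show ?thesis
  proof (cases rule: arc_cases)
    case (horizontal i j' j)
    have ij: "i < j" using dot_less horizontal(3) .
    have s0: "s0 = i + j" "vertex_col (hd p) = j" unfolding s0_def horizontal(4) by auto
    have u: "vertex_time u = i + j'" "vertex_col u = j'" using horizontal(5) by auto
    have set: "Dot i j \<in> set p" using p horizontal(4) by (metis hd_in_set)
    have u_set: "(i, j') \<in> D \<Longrightarrow> u = Dot i j'" using horizontal(5) dot_less[of i j'] by auto
    define J' where "J' s = (if s < s0 then s - i else J s)" for s
    have "s < 2 * J' s" if "i + j' < s" "s < 2 * c" for s
      using J that horizontal(1,2) ij s0 unfolding J'_def by (cases "s = s0") auto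
    moreover have "J' (Suc s) = J' s \<or> J' (Suc s) = Suc (J' s)" if "i + j' \<le> s" "s < 2 * c" for s
    proof -
      consider "Suc s < s0" | "Suc s = s0" | "s0 \<le> s" by linarith
      then show ?thesis by cases (use J that s0 in \<open>auto simp: J'_def\<close>)
    qed
    moreover have "J' (Suc (Suc s)) + J' s = 2 * J' (Suc s)"
      if "i + j' \<le> s" "Suc (Suc s) \<le> 2 * c" "(Suc s - J' (Suc s), J' (Suc s)) \<notin> D" for s
    proof -
      consider "Suc (Suc s) < s0" | "Suc (Suc s) = s0" | "Suc s = s0" | "s0 \<le> s" by linarith
      then show ?thesis
      proof cases
        case 3
        then show ?thesis using that(3) J s0 horizontal(3) unfolding J'_def by auto
      qed (use J that s0 in \<open>auto simp: J'_def\<close>)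
    qed
    moreover have "Dot (s - J' s) (J' s) \<in> set (u # p)"
      if st: "i + j' \<le> s" "s < 2 * c" "(s - J' s, J' s) \<in> D" for s
    proof -
      consider "s = i + j'" | "i + j' < s" "s < s0" | "s0 \<le> s" using st by linarith
      then show ?thesis
      proof cases
        case 1
        then show ?thesis using st(3) u_set s0 horizontal(1) unfolding J'_def by auto
      next
        case 2
        then show ?thesis using st(3) horizontal(6)[of "s - i"] s0 unfolding J'_def by auto
      next
        case 3
        then show ?thesis using J st unfolding J'_def by auto
      qed
    qed
    moreover have "i + j' \<le> 2 * c" "J' (i + j') = j'" "J' (2 * c) = c"
      using J s0 horizontal(1) unfolding J'_def by auto
    ultimately have "lpath_from D (u # p) c J'"
      unfolding lpath_from_def Let_def list.sel u by blast
    then show ?thesis by blast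
  next
    case (vertical i j i')
    have ij: "i < j" using dot_less vertical(3) .
    have s0: "s0 = i' + j" "vertex_col (hd p) = j" using vertical(5) unfolding s0_def by auto
    have u: "vertex_time u = i + j" "vertex_col u = j" using vertical(4) by auto
    have i'j: "s0 = 2 * c \<or> i' < j \<and> (i', j) \<in> D"
      using vertical(5) hd dot_less[of i' j] s0 by auto
    define J' where "J' s = (if s < s0 then j else J s)" for s
    have "s < 2 * J' s" if "i + j < s" "s < 2 * c" for s
      using J that vertical(1,2) ij s0 i'j unfolding J'_def by (cases "s = s0") auto
    moreover have "J' (Suc s) = J' s \<or> J' (Suc s) = Suc (J' s)" if "i + j \<le> s" "s < 2 * c" for s
    proof -
      consider "Suc s < s0" | "Suc s = s0" | "s0 \<le> s" by linarith
      then show ?thesis by cases (use J that s0 in \<open>auto simp: J'_def\<close>)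
    qed
    moreover have "J' (Suc (Suc s)) + J' s = 2 * J' (Suc s)"
      if "i + j \<le> s" "Suc (Suc s) \<le> 2 * c" "(Suc s - J' (Suc s), J' (Suc s)) \<notin> D" for s
    proof -
      consider "Suc (Suc s) < s0" | "Suc (Suc s) = s0" | "Suc s = s0" | "s0 \<le> s" by linarith
      then show ?thesis
      proof cases
        case 3
        then show ?thesis using that(2,3) J s0 i'j unfolding J'_def by auto
      qed (use J that s0 in \<open>auto simp: J'_def\<close>)
    qed
    moreover have "Dot (s - J' s) (J' s) \<in> set (u # p)"
      if st: "i + j \<le> s" "s < 2 * c" "(s - J' s, J' s) \<in> D" for s
    proof -
      consider "s = i + j" | "i + j < s" "s < s0" | "s0 \<le> s" using st by linarith
      then show ?thesis
      proof cases
        case 1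
        then show ?thesis using s0 vertical(1,4) unfolding J'_def by auto
      next
        case 2
        then show ?thesis using st(3) vertical(6)[of "s - j"] s0 unfolding J'_def by auto
      next
        case 3
        then show ?thesis using J st unfolding J'_def by auto
      qed
    qed
    moreover have "i + j \<le> 2 * c" "J' (i + j) = j" "J' (2 * c) = c"
      using J s0 vertical(1) unfolding J'_def by auto
    ultimately have "lpath_from D (u # p) c J'"
      unfolding lpath_from_def Let_def list.sel u by blast
    then show ?thesis by blast
  qed
qed

lemma walk_lpath_from:
  "p \<noteq> [] \<Longrightarrow> last p = Boundary c \<Longrightarrow> set (vwalk_arcs p) \<subseteq> le_arcs D \<Longrightarrow> \<exists>J. lpath_from D p c J"
proof (induction p)
  case (Cons u p)
  show ?case
  proof (cases p)
    case Nil
    then have "lpath_from D (u # p) c (\<lambda>_. c)" using Cons.prems by (auto simp: lpath_from_def)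
    then show ?thesis by blast
  next
    case (Cons v p')
    then have arcs: "(u, v) \<in> le_arcs D" "set (vwalk_arcs p) \<subseteq> le_arcs D" using Cons.prems by auto
    obtain J where J: "lpath_from D p c J" using Cons.IH Cons.prems arcs Cons by auto
    \<comment> \<open>A boundary vertex entered by an arc is not a row label, whereas one left by an
      arc is. So it can only be the last vertex.\<close>
    have "m = c" if v: "v = Boundary m" for m
    proof (cases p')
      case Nil
      then show ?thesis using Cons.prems(2) Cons v by simp
    next
      case (Cons w p'')
      then have "(v, w) \<in> le_arcs D" using arcs \<open>p = v # p'\<close> by simp
      then have "m \<in> R" using v dot_row by (cases rule: arc_cases) auto
      moreover have "m \<notin> R" using arcs(1) v dot_col by (cases rule: arc_cases) auto
      ultimately show ?thesis by simp
    qed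
    then show ?thesis using lpath_from_Cons[OF J, of u] Cons arcs(1) by auto
  qed
qed simp

lemma walk_lpath:
  assumes p: "hd p = Boundary b" "last p = Boundary c" "set (vwalk_arcs p) \<subseteq> le_arcs D" "length p \<ge> 2"
  obtains J where "lpath D b c J"
    "\<And>s. 2 * b \<le> s \<Longrightarrow> s < 2 * c \<Longrightarrow> (s - J s, J s) \<in> D \<Longrightarrow> Dot (s - J s) (J s) \<in> set p"
proof -
  obtain v q where q: "p = Boundary b # q" "q \<noteq> []" "v = hd q"
    using p(1,4) by (cases p; cases "tl p") auto
  have arcs: "set (vwalk_arcs q) \<subseteq> le_arcs D" "(Boundary b, v) \<in> le_arcs D"
    using p(3) q by (cases q; simp)+
  \<comment> \<open>The path of the tail shows that \<open>v\<close> has time at most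
    \<open>2 * c\<close>; time increases along the first arc, whence \<open>b < c\<close>.\<close>
  obtain J0 where "lpath_from D q c J0" using walk_lpath_from[OF q(2) _ arcs(1)] p(2) q by auto
  then have "vertex_time v \<le> 2 * c" unfolding lpath_from_def Let_def q(3) by blast
  moreover have "2 * b < vertex_time v" using arcs(2) by (cases rule: arc_cases) auto
  ultimately have bc: "b < c" by linarith
  obtain J where "lpath_from D p c J" using walk_lpath_from[OF _ p(2,3)] q(1) by auto
  note J = this[unfolded lpath_from_def Let_def p(1) vertex_time.simps vertex_col.simps]
  have "lpath D b c J" unfolding lpath_def using J bc by blast
  then show ?thesis using that J by blast
qed

lemma le_path_lpath:
  assumes "le_path n D p"
  obtains b c J where "hd p = Boundary b" "last p = Boundary c" "lpath D b c J"
    "\<And>s. 2 * b \<le> s \<Longrightarrow> s < 2 * c \<Longrightarrow> (s - J s, J s) \<in> D \<Longrightarrow> Dot (s - J s) (J s) \<in> set p"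
proof -
  obtain b c where bc: "hd p = Boundary b" "last p = Boundary c"
    using assms unfolding le_path_def by auto
  have "set (vwalk_arcs p) \<subseteq> le_arcs D" "length p \<ge> 2"
    using assms unfolding le_path_def by (auto simp: vpath_def vwalk_def le_graph_def)
  from walk_lpath[OF bc this] show ?thesis using that[OF bc] by blast
qed

lemma lpath_le_path:
  assumes lp: "lpath D b c J" and labels: "R \<subseteq> {1..n}" "snd ` D \<subseteq> {1..n}"
  obtains p where "le_path n D p" "hd p = Boundary b" "last p = Boundary c"
    "set p \<subseteq> {Boundary b, Boundary c} \<union>
      {Dot i j | i j. J (i + j) = j \<and> 2 * b < i + j \<and> i + j < 2 * c}"
proof -
  have bc: "b < c" using lpathD(1)[OF lp] .
  obtain p where p: "p \<noteq> []" "last p = Boundary c" "set (vwalk_arcs (Boundary b # p)) \<subseteq> le_arcs D"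
    "distinct p" "set p \<subseteq> insert (Boundary c)
      {Dot i j | i j. (i, j) \<in> D \<and> J (i + j) = j \<and> 2 * b < i + j \<and> i + j < 2 * c}"
    using lpath_walk[OF lp, of "2 * b" "Boundary b"] bc by auto
  have "b \<in> {1..n}" "c \<in> {1..n}"
    using lpath_row[OF lp] lpath_col[OF lp] dot_row labels by fastforce+
  then have "set (Boundary b # p) \<subseteq> pverts (le_graph n D)"
    using p(5) unfolding le_graph_def by fastforce
  moreover have "Boundary b \<notin> set p" using p(5) bc by auto
  ultimately have "le_path n D (Boundary b # p)"
    using p(1-4) unfolding le_path_def vpath_def vwalk_def
    by (auto simp: le_graph_def Suc_le_eq)
  moreover have "set (Boundary b # p) \<subseteq> {Boundary b, Boundary c} \<union>
      {Dot i j | i j. J (i + j) = j \<and> 2 * b < i + j \<and> i + j < 2 * c}"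
    using p(5) by fastforce
  ultimately show ?thesis using that[of "Boundary b # p"] p(1,2) by simp
qed

text \<open>If two lattice paths of the family met, they would meet at a dot by
  \<open>meet_at_dot\<close>, and this dot would be a vertex of both graph paths.\<close>

lemma represented_in_forest_bases:
  assumes P: "non_touching n D P" and R: "R = row_labels n \<mu>"
  shows "represented_set n \<mu> P \<in> forest_bases D R"
proof -
  define A where "A = {s. \<exists>p\<in>P. hd p = Boundary s}"
  define pth where "pth s = (SOME p. p \<in> P \<and> hd p = Boundary s)" for s
  have pth: "pth s \<in> P" "hd (pth s) = Boundary s" if "s \<in> A" for s
    using someI_ex[of "\<lambda>p. p \<in> P \<and> hd p = Boundary s"] that unfolding A_def pth_def by auto
  have le: "le_path n D p" if "p \<in> P" for p using P that unfolding non_touching_def by blast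
  have ne: "p \<noteq> []" if "p \<in> P" for p using le[OF that] unfolding le_path_def by auto
  have disj: "p = q" if "p \<in> P" "q \<in> P" "x \<in> set p" "x \<in> set q" for p q x
    using P that unfolding non_touching_def pairwise_def disjnt_def by blast
  have "\<exists>c J. last (pth s) = Boundary c \<and> lpath D s c J \<and>
      (\<forall>t. 2 * s \<le> t \<longrightarrow> t < 2 * c \<longrightarrow> (t - J t, J t) \<in> D \<longrightarrow> Dot (t - J t) (J t) \<in> set (pth s))"
    if s: "s \<in> A" for s
  proof -
    from le_path_lpath[OF le[OF pth(1)[OF s]]] obtain b c J where
      "hd (pth s) = Boundary b" "last (pth s) = Boundary c" "lpath D b c J"
      "\<And>t. 2 * b \<le> t \<Longrightarrow> t < 2 * c \<Longrightarrow> (t - J t, J t) \<in> D \<Longrightarrow> Dot (t - J t) (J t) \<in> set (pth s)"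
      by metis
    then show ?thesis using pth(2)[OF s] by auto
  qed
  then obtain f \<Gamma> where f: "\<And>s. s \<in> A \<Longrightarrow> last (pth s) = Boundary (f s)"
    "\<And>s. s \<in> A \<Longrightarrow> lpath D s (f s) (\<Gamma> s)"
    "\<And>s t. s \<in> A \<Longrightarrow> 2 * s \<le> t \<Longrightarrow> t < 2 * f s \<Longrightarrow> (t - \<Gamma> s t, \<Gamma> s t) \<in> D \<Longrightarrow>
      Dot (t - \<Gamma> s t) (\<Gamma> s t) \<in> set (pth s)"
    by metis
  have inj: "s = s'" if "s \<in> A" "s' \<in> A" "x \<in> set (pth s)" "x \<in> set (pth s')" for s s' x
    using disj[OF pth(1)[OF that(1)] pth(1)[OF that(2)] that(3,4)] pth(2)[OF that(1)] pth(2)[OF that(2)]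
    by (metis le_vertex.inject(1))
  have "inj_on f A"
  proof (rule inj_onI)
    fix s s' assume s: "s \<in> A" "s' \<in> A" "f s = f s'"
    have "last (pth s) \<in> set (pth s)" "last (pth s') \<in> set (pth s')"
      using ne pth(1) s by auto
    then show "s = s'" using inj[OF s(1,2)] f(1) s by metis
  qed
  moreover have "path_forest D A f \<Gamma>"
    unfolding path_forest_def
  proof (intro conjI ballI impI notI)
    fix i l assume il: "i \<in> A" "l \<in> A" "f i \<noteq> f l"
      and "\<exists>s. meet i (f i) (\<Gamma> i) l (f l) (\<Gamma> l) s"
    then obtain s where "meet i (f i) (\<Gamma> i) l (f l) (\<Gamma> l) s" by blast
    moreover have "i \<noteq> l" using il by auto
    ultimately obtain s where s: "meet i (f i) (\<Gamma> i) l (f l) (\<Gamma> l) s" "(s - \<Gamma> i s, \<Gamma> i s) \<in> D"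
      using meet_at_dot[OF f(2)[OF il(1)] f(2)[OF il(2)]] by blast
    have "Dot (s - \<Gamma> i s) (\<Gamma> i s) \<in> set (pth i)" "Dot (s - \<Gamma> i s) (\<Gamma> i s) \<in> set (pth l)"
      using f(3)[OF il(1), of s] f(3)[OF il(2), of s] s unfolding meet_def by auto
    then show False using inj[OF il(1,2)] \<open>i \<noteq> l\<close> by blast
  qed (use f in blast)
  moreover have "represented_set n \<mu> P = base R A f"
  proof -
    have "(\<exists>p\<in>P. last p = Boundary t) \<longleftrightarrow> t \<in> f ` A" for t
    proof
      assume "\<exists>p\<in>P. last p = Boundary t"
      then obtain p where p: "p \<in> P" "last p = Boundary t" by blast
      obtain b where b: "hd p = Boundary b" using le_path_lpath[OF le[OF p(1)]] by metis
      then have bA: "b \<in> A" using p(1) unfolding A_def by blast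
      have "hd p \<in> set p" "hd (pth b) \<in> set (pth b)" using ne p(1) pth(1)[OF bA] by auto
      then have "p = pth b" using disj[OF p(1) pth(1)[OF bA]] b pth(2)[OF bA] by metis
      then show "t \<in> f ` A" using f(1)[OF bA] p(2) bA by auto
    qed (use f(1) pth(1) in blast)
    then show ?thesis unfolding represented_set_def base_def R A_def[symmetric] by blast
  qed
  ultimately show ?thesis using forest_basesI by metis
qed

text \<open>The dots of a graph path lie on its lattice path, so a common dot is a meeting. Boundary
  vertices are not shared, as sinks are not rows and \<open>f\<close> is injective.\<close>

lemma forest_base_represented:
  assumes F: "path_forest D A f \<Gamma>" "inj_on f A" and labels: "R \<subseteq> {1..n}" "snd ` D \<subseteq> {1..n}"
    and R: "R = row_labels n \<mu>"
  shows "\<exists>P. non_touching n D P \<and> represented_set n \<mu> P = base R A f"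
proof -
  have lp: "lpath D i (f i) (\<Gamma> i)" if "i \<in> A" for i using F(1) that unfolding path_forest_def by blast
  define inner where "inner i = {Dot a b | a b. \<Gamma> i (a + b) = b \<and> 2 * i < a + b \<and> a + b < 2 * f i}" for i
  have "\<exists>p. le_path n D p \<and> hd p = Boundary i \<and> last p = Boundary (f i) \<and>
      set p \<subseteq> {Boundary i, Boundary (f i)} \<union> inner i" if "i \<in> A" for i
    by (rule lpath_le_path[OF lp[OF that] labels, folded inner_def]) (intro exI conjI; assumption)
  then obtain pth where pth: "\<And>i. i \<in> A \<Longrightarrow> le_path n D (pth i)" "\<And>i. i \<in> A \<Longrightarrow> hd (pth i) = Boundary i"
    "\<And>i. i \<in> A \<Longrightarrow> last (pth i) = Boundary (f i)"
    "\<And>i. i \<in> A \<Longrightarrow> set (pth i) \<subseteq> {Boundary i, Boundary (f i)} \<union> inner i"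
    by metis
  have "disjnt (set (pth i)) (set (pth l))" if il: "i \<in> A" "l \<in> A" "i \<noteq> l" for i l
  proof (rule ccontr)
    assume "\<not> disjnt (set (pth i)) (set (pth l))"
    then obtain x where x: "x \<in> set (pth i)" "x \<in> set (pth l)" unfolding disjnt_def by blast
    have ne: "f i \<noteq> f l" using il F(2) by (auto dest: inj_onD)
    have "i \<noteq> f l" "l \<noteq> f i" using il forest_rows(1)[OF F(1)] forest_cols[OF F(1)] by blast+
    then have "x \<in> inner i" "x \<in> inner l"
      using x pth(4)[OF il(1)] pth(4)[OF il(2)] ne il(3) unfolding inner_def by auto
    then obtain a b where "\<Gamma> i (a + b) = b" "\<Gamma> l (a + b) = b" "2 * i < a + b" "a + b < 2 * f i"
      "2 * l < a + b" "a + b < 2 * f l"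
      unfolding inner_def by auto
    then have "meet i (f i) (\<Gamma> i) l (f l) (\<Gamma> l) (a + b)" unfolding meet_def by simp
    then show False using F(1) il ne unfolding path_forest_def by blast
  qed
  then have "non_touching n D (pth ` A)"
    using pth(1) forest_rows(2)[OF F(1)] unfolding non_touching_def pairwise_def by blast
  moreover have "represented_set n \<mu> (pth ` A) = base R A f"
  proof -
    have "{s. \<exists>p\<in>pth ` A. hd p = Boundary s} = A" "{t. \<exists>p\<in>pth ` A. last p = Boundary t} = f ` A"
      using pth(2,3) by auto
    then show ?thesis unfolding represented_set_def base_def R by simp
  qed
  ultimately show ?thesis by blast
qed

lemma le_bases_eq_forest_bases:
  assumes "R = row_labels n \<mu>" "R \<subseteq> {1..n}" "snd ` D \<subseteq> {1..n}"
  shows "le_bases n \<mu> D = forest_bases D R"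
proof (intro equalityI subsetI)
  fix B assume "B \<in> le_bases n \<mu> D"
  then show "B \<in> forest_bases D R"
    unfolding le_bases_def using represented_in_forest_bases assms(1) by blast
next
  fix B assume "B \<in> forest_bases D R"
  then obtain A f \<Gamma> where B: "B = base R A f" "inj_on f A" "path_forest D A f \<Gamma>"
    unfolding forest_bases_def by blast
  from forest_base_represented[OF B(3,2) assms(2,3,1)] show "B \<in> le_bases n \<mu> D"
    unfolding le_bases_def B(1) by blast
qed

end

section \<open>Labels of rows, columns and boxes\<close>

lemma column_length_le_iff:
  assumes "young_diagram n k \<mu>" "a < k"
  shows "a < column_length \<mu> c \<longleftrightarrow> c < \<mu> ! a"
proof -
  \<comment> \<open>Row lengths decrease weakly, so the rows that reach column \<open>c\<close> form
    an initial segment.\<close>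
  have len: "length \<mu> = k" and mono: "\<And>a b. a \<le> b \<Longrightarrow> b < k \<Longrightarrow> \<mu> ! b \<le> \<mu> ! a"
    using assms(1) unfolding young_diagram_def by (auto simp: sorted_wrt_iff_nth_less le_less)
  show ?thesis
  proof
    assume "c < \<mu> ! a"
    then have "{..a} \<subseteq> {b. b < length \<mu> \<and> c < \<mu> ! b}" using mono[of _ a] assms(2) len by fastforce
    then have "card {..a} \<le> column_length \<mu> c" unfolding column_length_def by (intro card_mono) auto
    then show "a < column_length \<mu> c" by simp
  next
    assume a: "a < column_length \<mu> c"
    show "c < \<mu> ! a"
    proof (rule ccontr)
      assume "\<not> c < \<mu> ! a"
      then have "b < a" if "b < k" "c < \<mu> ! b" for b
        using mono[of a b] that by (cases "b < a") auto
      then have "{b. b < length \<mu> \<and> c < \<mu> ! b} \<subseteq> {..<a}" using len by auto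
      then have "column_length \<mu> c \<le> card {..<a}" unfolding column_length_def by (intro card_mono) auto
      then show False using a by simp
    qed
  qed
qed

text \<open>Along the boundary path, the vertical step of a row precedes the horizontal step of a
  column iff the two have a common box. This turns membership in the diagram into a comparison of
  labels.\<close>

lemma box_iff_labels_less:
  assumes y: "young_diagram n k \<mu>" and "a < k" "c < n - k"
  shows "row_label n \<mu> a < column_label n \<mu> c \<longleftrightarrow> c < \<mu> ! a"
    "row_label n \<mu> a \<noteq> column_label n \<mu> c"
proof -
  have len: "length \<mu> = k" and "\<mu> ! a \<le> n - k"
    using y assms(2) unfolding young_diagram_def by (auto dest: nth_mem)
  then show "row_label n \<mu> a < column_label n \<mu> c \<longleftrightarrow> c < \<mu> ! a"
    "row_label n \<mu> a \<noteq> column_label n \<mu> c"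
    using column_length_le_iff[OF y assms(2), of c] assms(3)
    unfolding row_label_def column_label_def by linarith+
qed

lemma le_diagram_dots:
  assumes "le_diagram n k \<mu> D"
  shows "le_dots D (row_labels n \<mu>)" "row_labels n \<mu> \<subseteq> {1..n}" "snd ` D \<subseteq> {1..n}"
proof -
  have y: "young_diagram n k \<mu>" and DB: "D \<subseteq> boxes n \<mu>"
    and le: "\<And>i i' j j'. (i, j) \<in> boxes n \<mu> \<Longrightarrow> (i', j) \<in> D \<Longrightarrow> (i, j') \<in> D \<Longrightarrow> i' < i \<Longrightarrow> j < j' \<Longrightarrow> (i, j) \<in> D"
    using assms unfolding le_diagram_def by blast+
  have len: "length \<mu> = k" "k \<le> n" and bound: "\<And>a. a < k \<Longrightarrow> \<mu> ! a \<le> n - k"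
    using y unfolding young_diagram_def by (auto dest: nth_mem)
  have box: "\<exists>a c. i = row_label n \<mu> a \<and> j = column_label n \<mu> c \<and> a < k \<and> c < n - k \<and> c < \<mu> ! a"
    if "(i, j) \<in> boxes n \<mu>" for i j
    using that bound unfolding boxes_def len by fastforce
  show "row_labels n \<mu> \<subseteq> {1..n}"
    using bound len unfolding row_labels_def row_label_def by fastforce
  show "snd ` D \<subseteq> {1..n}"
  proof
    fix j assume "j \<in> snd ` D"
    then obtain a c where j: "j = column_label n \<mu> c" "c < n - k" using box DB by force
    have "column_length \<mu> c \<le> k"
      unfolding column_length_def len using card_mono[of "{..<k}" "{a. a < k \<and> c < \<mu> ! a}"] by auto
    then show "j \<in> {1..n}" using j len unfolding column_label_def by auto
  qed
  show "le_dots D (row_labels n \<mu>)"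
  proof
    show "finite (row_labels n \<mu>)" unfolding row_labels_def by simp
    have "boxes n \<mu> \<subseteq> row_label n \<mu> ` {..<k} \<times> column_label n \<mu> ` {..<n - k}"
    proof
      fix x assume x: "x \<in> boxes n \<mu>"
      obtain i j where ij: "x = (i, j)" by (cases x)
      show "x \<in> row_label n \<mu> ` {..<k} \<times> column_label n \<mu> ` {..<n - k}"
        using box[OF x[unfolded ij]] unfolding ij by auto
    qed
    with DB have "D \<subseteq> row_label n \<mu> ` {..<k} \<times> column_label n \<mu> ` {..<n - k}" by (rule subset_trans)
    then show "finite D" by (rule finite_subset) simp
  next
    fix i j assume d: "(i, j) \<in> D"
    obtain a c where ac: "i = row_label n \<mu> a" "j = column_label n \<mu> c" "a < k" "c < n - k" "c < \<mu> ! a"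
      using box[OF subsetD[OF DB d]] by (elim exE conjE)
    show "i \<in> row_labels n \<mu>" using ac len unfolding row_labels_def by auto
    show "j \<notin> row_labels n \<mu>"
      using box_iff_labels_less(2)[OF y _ ac(4)] ac(2) len unfolding row_labels_def by force
    show "i < j" using box_iff_labels_less(1)[OF y ac(3,4)] ac by simp
  next
    fix i i' j j' assume d: "(i', j) \<in> D" "(i, j') \<in> D" and less: "i' < i" "i < j" "j < j'"
    obtain a where a: "i = row_label n \<mu> a" "a < k" using box[OF subsetD[OF DB d(2)]] by (elim exE conjE)
    obtain c where c: "j = column_label n \<mu> c" "c < n - k" using box[OF subsetD[OF DB d(1)]] by (elim exE conjE)
    \<comment> \<open>By \<open>i < j\<close> the corner required by the Le-condition is a box of
      the diagram.\<close>
    have "(i, j) \<in> boxes n \<mu>"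
      using box_iff_labels_less(1)[OF y a(2) c(2)] a c less(2) len unfolding boxes_def by auto
    then show "(i, j) \<in> D" using le d less by blast
  qed
qed

theorem corollary3p7:
  fixes E :: "nat set" and \<B> :: "nat set set"
  assumes "positroid E \<B>"
  shows "pure_O_sequence (h_vector \<B>)"
proof -
  obtain n k \<mu> D where D: "le_diagram n k \<mu> D" "\<B> = le_bases n \<mu> D" and M: "matroid E \<B>"
    using assms unfolding positroid_def by blast
  interpret le_dots D "row_labels n \<mu>" by (rule le_diagram_dots(1)[OF D(1)])
  have "\<B> = forest_bases D (row_labels n \<mu>)"
    unfolding D(2) by (rule le_bases_eq_forest_bases[OF refl le_diagram_dots(2,3)[OF D(1)]])
  then show ?thesis using pure_O_sequence_forest_bases M by simp
qed

end
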